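(* Let $V$ be a Banach space with a bimonotone FDD $(V_j)$, and view each $V_n^*$ isometrically as a subspace of $V^*$ (via the coordinate projection onto $V_n$). Let $(\varepsilon_n)\subset(0,1)$ be a null sequence with $\sum_n\varepsilon_n<1/3$, and for each $n$ let $(x^*_{(n,i)}:i=1,\dots,l_n)$ be a finite $\varepsilon_n$-net in $B_{V_n^*}$. Let $$A=\Big\{\sum_n a_nx^*_{(n,i_n)}:\ (i_n)\in\prod_n\{1,\dots,l_n\},\ \Big\|\sum_na_nx^*_{(n,i_n)}\Big\|\le1\Big\},$$ and equip $V$ with the (equivalent) norm $|||v|||=\sup_{v^*\in A}|v^*(v)|$. Let $\Gamma=\{(n,i):n\in\mathbb N,1\le i\le l_n\}$, ordered lexicographically, let $(e_\gamma)_{\gamma\in\Gamma}$ be the unit vector basis of $c_{00}(\Gamma)$ with coordinate functionals $(e^*_\gamma)$, let $$B=\Big\{\sum_na_ne^*_{(n,i_n)}:\ (i_n)\in\prod_n\{1,\dots,l_n\},\ \Big\|\sum_na_nx^*_{(n,i_n)}\Big\|\le1\Big\},$$ define $\|x\|=\sup_{w^*\in B}w^*(x)$ for $x\in c_{00}(\Gamma)$, and let $W$ be the completion of $c_{00}(\Gamma)$ under this norm. Then $(e_\gamma:\gamma\in\Gamma)$ (in the lexicographic order) is a basis of $W$, the map $$J:\sum_nv_n\mapsto\sum_{n=1}^\infty\sum_{i=1}^{l_n}x^*_{(n,i)}(v_n)e_{(n,i)}\qquad(v_n\in V_n)$$ defines an isometric embedding of $(V,|||\cdot|||)$ into $W$,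 and (a) $(e_\gamma)$ is $1$-unconditional if $(V_j)$ is $1$-unconditional; (b) $(e_\gamma)$ is shrinking if $(V_j)$ is shrinking; (c) $(e_\gamma)$ is shrinking and boundedly complete if $V$ is reflexive.
   Context: An FDD $(V_j)$ is bimonotone if $\|\sum_{j=m}^n v_j\|\le\|\sum_j v_j\|$ for all $m\le n$ and $v_j\in V_j$; it is $1$-unconditional if $\|\sum\sigma_jv_j\|=\|\sum v_j\|$ for all signs $\sigma_j=\pm1$. An FDD or basis is shrinking if the biorthogonal functionals span a dense subspace of the dual; a basis $(e_\gamma)$ is boundedly complete if $\sum a_\gamma e_\gamma$ converges whenever its partial sums are bounded.
   Formalization: The net elements x*_{(n,i)} are assumed non-zero (so each V_n is non-zero): if some x*_{(n,i)} = 0, its coefficient in B is unconstrained, the norm of e_{(n,i)} is infinite and W is undefined. *)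

theory Defs
  imports "HOL-Analysis.Analysis"
begin

definition is_FDD :: "(nat \<Rightarrow> 'v::banach set) \<Rightarrow> bool" where
  "is_FDD V \<longleftrightarrow> (\<forall>j. subspace (V j) \<and> (\<exists>B. finite B \<and> V j = span B)) \<and>
     (\<forall>v. \<exists>!u. (\<forall>j. u j \<in> V j) \<and> u sums v)"

definition coord :: "(nat \<Rightarrow> 'v::banach set) \<Rightarrow> nat \<Rightarrow> 'v \<Rightarrow> 'v" where
  "coord V n v = (THE u. (\<forall>j. u j \<in> V j) \<and> u sums v) n"

definition bimonotone_FDD :: "(nat \<Rightarrow> 'v::banach set) \<Rightarrow> bool" where
  "bimonotone_FDD V \<longleftrightarrow> (\<forall>v N m n. (\<forall>j. v j \<in> V j) \<longrightarrow> m \<le> n \<longrightarrow> n < N \<longrightarrow>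
      norm (\<Sum>j\<in>{m..n}. v j) \<le> norm (\<Sum>j<N. v j))"

definition unconditional_FDD :: "(nat \<Rightarrow> 'v::banach set) \<Rightarrow> bool" where
  "unconditional_FDD V \<longleftrightarrow> (\<forall>v N (\<sigma>::nat \<Rightarrow> real). (\<forall>j. v j \<in> V j) \<longrightarrow>
      (\<forall>j. \<sigma> j = 1 \<or> \<sigma> j = -1) \<longrightarrow>
      norm (\<Sum>j<N. \<sigma> j *\<^sub>R v j) = norm (\<Sum>j<N. v j))"

text \<open>V n dual, viewed inside the dual of the whole space via the coordinate projection.\<close>
definition dual_comp :: "(nat \<Rightarrow> 'v::banach set) \<Rightarrow> nat \<Rightarrow> ('v \<Rightarrow>\<^sub>L real) set" where
  "dual_comp V n = {f. \<forall>v. blinfun_apply f v = blinfun_apply f (coord V n v)}"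

definition shrinking_FDD :: "(nat \<Rightarrow> 'v::banach set) \<Rightarrow> bool" where
  "shrinking_FDD V \<longleftrightarrow> closure (span (\<Union>n. dual_comp V n)) = UNIV"

definition reflexive :: "'v::banach itself \<Rightarrow> bool" where
  "reflexive _ \<longleftrightarrow> (\<forall>\<phi> :: ('v \<Rightarrow>\<^sub>L real) \<Rightarrow>\<^sub>L real. \<exists>v. \<forall>f. blinfun_apply \<phi> f = blinfun_apply f v)"

text \<open>Admissible data (a, i): indices 1 \<le> i n \<le> l n, and the (weak-star) sum
  of a n x(n, i n) is a functional of norm at most 1.\<close>
definition adm :: "(nat \<Rightarrow> nat) \<Rightarrow> (nat \<Rightarrow> nat \<Rightarrow> ('v::banach \<Rightarrow>\<^sub>L real)) \<Rightarrow>
    (nat \<Rightarrow> real) \<Rightarrow> (nat \<Rightarrow> nat) \<Rightarrow> bool" where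
  "adm l x a ii \<longleftrightarrow> (\<forall>n. 1 \<le> ii n \<and> ii n \<le> l n) \<and>
     (\<forall>v. summable (\<lambda>n. a n * blinfun_apply (x n (ii n)) v)) \<and>
     (\<forall>v. \<bar>\<Sum>n. a n * blinfun_apply (x n (ii n)) v\<bar> \<le> norm v)"

definition tnorm :: "(nat \<Rightarrow> nat) \<Rightarrow> (nat \<Rightarrow> nat \<Rightarrow> ('v::banach \<Rightarrow>\<^sub>L real)) \<Rightarrow> 'v \<Rightarrow> real" where
  "tnorm l x v = Sup {\<bar>\<Sum>n. a n * blinfun_apply (x n (ii n)) v\<bar> | a ii. adm l x a ii}"

definition wnorm :: "(nat \<Rightarrow> nat) \<Rightarrow> (nat \<Rightarrow> nat \<Rightarrow> ('v::banach \<Rightarrow>\<^sub>L real)) \<Rightarrow>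
    (nat \<times> nat \<Rightarrow> real) \<Rightarrow> real" where
  "wnorm l x c = Sup {(\<Sum>n. a n * c (n, ii n)) | a ii. adm l x a ii}"

definition Gam :: "(nat \<Rightarrow> nat) \<Rightarrow> (nat \<times> nat) set" where
  "Gam l = {(n, i). 1 \<le> i \<and> i \<le> l n}"

definition lex_less :: "nat \<times> nat \<Rightarrow> nat \<times> nat \<Rightarrow> bool" where
  "lex_less p q \<longleftrightarrow> fst p < fst q \<or> (fst p = fst q \<and> snd p < snd q)"

definition lexrank :: "(nat \<times> nat) set \<Rightarrow> nat \<times> nat \<Rightarrow> nat" where
  "lexrank G g = card {d \<in> G. lex_less d g}"

definition psum :: "(nat \<times> nat) set \<Rightarrow> (nat \<times> nat \<Rightarrow> real) \<Rightarrow> (nat \<times> nat \<Rightarrow> 'w::real_normed_vector)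
    \<Rightarrow> nat \<Rightarrow> 'w" where
  "psum G c e k = (\<Sum>g\<in>{g\<in>G. lexrank G g < k}. c g *\<^sub>R e g)"

definition lex_basis :: "(nat \<times> nat) set \<Rightarrow> (nat \<times> nat \<Rightarrow> 'w::banach) \<Rightarrow> bool" where
  "lex_basis G e \<longleftrightarrow> (\<forall>w. \<exists>!c. (\<forall>g. g \<notin> G \<longrightarrow> c g = 0) \<and> psum G c e \<longlonglongrightarrow> w)"

definition uncond_basis :: "(nat \<times> nat) set \<Rightarrow> (nat \<times> nat \<Rightarrow> 'w::banach) \<Rightarrow> bool" where
  "uncond_basis G e \<longleftrightarrow> (\<forall>F c (\<sigma>::nat \<times> nat \<Rightarrow> real). finite F \<longrightarrow> F \<subseteq> G \<longrightarrow>
      (\<forall>g. \<sigma> g = 1 \<or> \<sigma> g = -1) \<longrightarrow>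
      norm (\<Sum>g\<in>F. (\<sigma> g * c g) *\<^sub>R e g) = norm (\<Sum>g\<in>F. c g *\<^sub>R e g))"

definition shrinking_basis :: "(nat \<times> nat) set \<Rightarrow> (nat \<times> nat \<Rightarrow> 'w::banach) \<Rightarrow> bool" where
  "shrinking_basis G e \<longleftrightarrow> closure (span {f :: 'w \<Rightarrow>\<^sub>L real. \<exists>g\<in>G. \<forall>d\<in>G.
       blinfun_apply f (e d) = (if d = g then 1 else 0)}) = UNIV"

definition bcomplete_basis :: "(nat \<times> nat) set \<Rightarrow> (nat \<times> nat \<Rightarrow> 'w::banach) \<Rightarrow> bool" where
  "bcomplete_basis G e \<longleftrightarrow> (\<forall>c. (\<forall>g. g \<notin> G \<longrightarrow> c g = 0) \<longrightarrow>
      bounded (range (psum G c e)) \<longrightarrow> convergent (psum G c e))"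

end

theory Submission
  imports Defs "HOL-Complex_Analysis.Great_Picard"
begin

text \<open>
  Truncating the coefficients of an admissible pair \<open>(a, ii)\<close> at some level keeps it admissible, because
  the FDD is bimonotone, and an initial segment of the lexicographic order cuts each selection
  \<open>ii\<close> at one level. Hence the functionals \<open>\<Sum>\<^sub>n a\<^sub>n e\<^sup>*(n, i\<^sub>n)\<close>, which define the norm of \<open>W\<close>, are mapped
  to each other by the basis projections; the basis is monotone, and it is unconditional when
  signs preserve admissibility.

  By compactness every \<open>w\<close> attains its norm on this set of functionals. If \<open>V\<close> is shrinking, their tails
  tend to \<open>0\<close> in norm, and Simons' inequality transfers this to every functional on \<open>W\<close>.
  If \<open>V\<close> is reflexive and some bounded series diverged, then
  functionals that detect successive blocks of it could be glued to one selection \<open>ii\<close>. Along \<open>ii\<close> the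
  coefficients are \<open>x n (ii n) v\<close> for a single \<open>v\<close>, and the convergence of the FDD expansion of \<open>v\<close> contradicts
  the size of the blocks.
\<close>

section \<open>Hahn-Banach theorems\<close>

text \<open>In general W is much larger than the copy of V: the coefficients \<open>c (n, i)\<close>
  on one level are arbitrary, whereas the values \<open>x n i\<close> at a vector of V obey every
  linear relation among the net vectors. A vector of W therefore need not come from V. But each
  functional that computes the norm sees a single index per level, and the size of its tails is
  governed by V. All properties are checked on these functionals, one selection at a time; the work
  lies in showing that this is enough.

  For shrinkingness it is enough because the functionals form a boundary: the norm of each
  \<open>w\<close> is attained, not merely approximated. Pointwise control on a norming set would
  not in general pass to the whole dual. For bounded completeness, reflexivity speaks about one
  selection only, while the functionals detecting different blocks use different ones; gluing them
  is possible because the blocks occupy disjoint ranges of levels.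

  The net vectors must be nonzero: the coefficient of a zero vector would be unconstrained and the
  supremum in \<open>wnorm\<close> infinite.\<close>

definition sublinear :: "('a::real_vector \<Rightarrow> real) \<Rightarrow> bool" where
  "sublinear p \<longleftrightarrow> (\<forall>x y. p (x + y) \<le> p x + p y) \<and> (\<forall>t x. t > 0 \<longrightarrow> p (t *\<^sub>R x) = t * p x) \<and> p 0 = 0"

lemma sublinear_minus_le: "sublinear p \<Longrightarrow> - p (- x) \<le> p x"
  using spec[of "\<lambda>y. p (x + y) \<le> p x + p y" "- x"] by (simp add: sublinear_def)

text \<open>Scaling by \<open>t\<close> and back by \<open>1 / t\<close> turns the one-sided
  estimate into an equality.\<close>

lemma sublinearI:
  assumes "\<And>x y. p (x + y) \<le> p x + p y" and "\<And>t x. t > 0 \<Longrightarrow> p (t *\<^sub>R x) \<le> t * p x" and "p 0 = 0"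
  shows "sublinear p"
  unfolding sublinear_def
proof (intro conjI allI impI)
  fix t :: real and x :: 'a assume t: "t > 0"
  have "p ((1/t) *\<^sub>R (t *\<^sub>R x)) \<le> (1/t) * p (t *\<^sub>R x)"
    using t by (intro assms(2)) auto
  then have "t * p x \<le> p (t *\<^sub>R x)"
    using t by (simp add: field_simps)
  with assms(2)[OF t, of x] show "p (t *\<^sub>R x) = t * p x" by linarith
qed (use assms in auto)

lemma sublinear_odd_imp_linear:
  assumes p: "sublinear p" and odd: "\<And>x. p (- x) \<le> - p x"
  shows "linear p"
proof
  have neg: "p (- x) = - p x" for x
    using sublinear_minus_le[OF p, of x] odd[of x] by linarith
  show add: "p (x + y) = p x + p y" for x y
  proof (rule antisym)
    show "p (x + y) \<le> p x + p y" using p by (simp add: sublinear_def)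
    have "p (- x + - y) \<le> p (- x) + p (- y)" using p unfolding sublinear_def by blast
    moreover have "p (- x + - y) = - p (x + y)" using neg[of "x + y"] by simp
    ultimately show "p x + p y \<le> p (x + y)" by (simp add: neg)
  qed
  show "p (t *\<^sub>R x) = t *\<^sub>R p x" for t x
  proof -
    consider "t > 0" | "t = 0" | "- t > 0" by linarith
    then show ?thesis
    proof cases
      case 3
      then have "p ((- t) *\<^sub>R x) = (- t) * p x" using p unfolding sublinear_def by blast
      then show ?thesis using neg[of "t *\<^sub>R x"] by simp
    qed (use p in \<open>auto simp: sublinear_def\<close>)
  qed
qed

text \<open>A sublinear functional that is minimal below \<open>p\<close> equals each of its shifts
  \<open>x \<mapsto> inf\<^sub>t (q (x + t v) - t q v)\<close>; evaluating at \<open>- v\<close> shows that it is odd.\<close>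
lemma hahn_banach_sublinear:
  fixes p :: "'a::real_vector \<Rightarrow> real"
  assumes p: "sublinear p"
  obtains g where "linear g" "\<And>x. g x \<le> p x"
proof -
  define A where "A = {q. sublinear q \<and> q \<le> p}"
  \<comment> \<open>The order is reversed: Zorn's lemma yields a maximal element, and a minimal
    sublinear functional is wanted.\<close>
  define P where "P = (\<lambda>q q' :: 'a \<Rightarrow> real. q' \<le> q)"
  \<comment> \<open>The bound depends on \<open>p\<close> alone, so infima over chains are
    finite.\<close>
  have lower: "- p (- x) \<le> q x" if "q \<in> A" for q x
  proof -
    have "q (- x) \<le> p (- x)" using that by (auto simp: A_def le_fun_def)
    moreover have "- q (- x) \<le> q x" using that sublinear_minus_le by (auto simp: A_def)
    ultimately show ?thesis by linarith
  qed
  have "\<exists>m\<in>A. \<forall>a\<in>A. P m a \<longrightarrow> a = m"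
  proof (rule predicate_Zorn)
    show "partial_order_on A (relation_of P A)"
      by (auto simp: P_def partial_order_on_def preorder_on_def refl_on_def trans_def antisym_def relation_of_def)
  next
    fix C assume C: "C \<in> Chains (relation_of P A)"
    then have CA: "C \<subseteq> A" and lin: "\<And>q q'. q \<in> C \<Longrightarrow> q' \<in> C \<Longrightarrow> q \<le> q' \<or> q' \<le> q"
      by (auto simp: Chains_def relation_of_def P_def)
    show "\<exists>u\<in>A. \<forall>a\<in>C. P a u"
    proof (cases "C = {}")
      case True
      then show ?thesis using p by (auto simp: A_def)
    next
      case False
      define u where "u = (\<lambda>x. INF q\<in>C. q x)"
      have bdd: "bdd_below ((\<lambda>q. q x) ` C)" for x
        using lower CA by (intro bdd_belowI2[where m = "- p (- x)"]) auto
      have le: "u x \<le> q x" if "q \<in> C" for q x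
        unfolding u_def using bdd that by (rule cINF_lower)
      have ge: "m \<le> u x" if "\<And>q. q \<in> C \<Longrightarrow> m \<le> q x" for m x
        unfolding u_def using False that by (intro cINF_greatest) auto
      have sub: "sublinear q" if "q \<in> C" for q using that CA by (auto simp: A_def)
      have "sublinear u"
      proof (rule sublinearI)
        fix x y
        have "u (x + y) \<le> q x + q' y" if qq: "q \<in> C" "q' \<in> C" for q q'
        proof -
          \<comment> \<open>In a chain one of \<open>q\<close> and \<open>q'\<close> lies below the
            other, and that one serves for both terms.\<close>
          obtain r where r: "r \<in> C" "r x \<le> q x" "r y \<le> q' y"
            using lin[OF qq] qq by (auto simp: le_fun_def)
          then have "u (x + y) \<le> r x + r y"
            using le[OF r(1), of "x + y"] sub[OF r(1)] by (meson order_trans sublinear_def)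
          then show ?thesis using r by linarith
        qed
        then have "u (x + y) - q x \<le> u y" if "q \<in> C" for q
          using that by (intro ge) (metis diff_le_eq add.commute)
        then have "u (x + y) - u y \<le> u x"
          by (intro ge) (simp add: algebra_simps)
        then show "u (x + y) \<le> u x + u y" by simp
      next
        fix t :: real and x assume t: "t > 0"
        have "u (t *\<^sub>R x) / t \<le> u x"
        proof (rule ge)
          fix q assume "q \<in> C"
          then have "u (t *\<^sub>R x) \<le> t * q x"
            using le[of q "t *\<^sub>R x"] sub[of q] t by (simp add: sublinear_def)
          then show "u (t *\<^sub>R x) / t \<le> q x" using t by (simp add: field_simps)
        qed
        then show "u (t *\<^sub>R x) \<le> t * u x" using t by (simp add: field_simps)
      next
        show "u 0 = 0"
          using False le[of _ 0] ge[of 0 0] sub by (force simp: sublinear_def)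
      qed
      moreover have "u \<le> p"
      proof -
        obtain q where "q \<in> C" using False by blast
        then have "u x \<le> q x" "q x \<le> p x" for x using le CA by (auto simp: A_def le_fun_def)
        then show ?thesis unfolding le_fun_def by (meson order_trans)
      qed
      ultimately show ?thesis using le by (auto simp: A_def P_def le_fun_def)
    qed
  qed
  then obtain q where q: "sublinear q" "q \<le> p" and min: "\<And>r. sublinear r \<Longrightarrow> r \<le> q \<Longrightarrow> r = q"
    unfolding A_def P_def by (metis (mono_tags, lifting) mem_Collect_eq order_trans)
  have q_add: "q (x + y) \<le> q x + q y" and q_scale: "t > 0 \<Longrightarrow> q (t *\<^sub>R x) = t * q x" and q_0: "q 0 = 0"
    for x y t using q(1) by (auto simp: sublinear_def)
  have "q (- v) \<le> - q v" for v
  proof -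
    define h where "h = (\<lambda>x t. q (x + t *\<^sub>R v) - t * q v)"
    define r where "r = (\<lambda>x. INF t\<in>{0..}. h x t)"
    have h_lower: "- q (- x) \<le> h x t" if "t \<ge> 0" for x t
    proof -
      have "q (t *\<^sub>R v) \<le> q (x + t *\<^sub>R v) + q (- x)" using q_add[of "x + t *\<^sub>R v" "- x"] by simp
      moreover have "q (t *\<^sub>R v) = t * q v" using q_scale[of t v] q_0 that by (cases "t = 0") auto
      ultimately show ?thesis by (simp add: h_def)
    qed
    have bdd: "bdd_below (h x ` {0..})" for x
      using h_lower by (intro bdd_belowI2[where m = "- q (- x)"]) auto
    have le: "r x \<le> h x t" if "t \<ge> 0" for x t
      unfolding r_def using bdd that by (intro cINF_lower) auto
    have ge: "m \<le> r x" if "\<And>t. t \<ge> 0 \<Longrightarrow> m \<le> h x t" for m x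
      unfolding r_def using that by (intro cINF_greatest) auto
    have "sublinear r"
    proof (rule sublinearI)
      fix x y
      have "r (x + y) \<le> h x s + h y t" if "s \<ge> 0" "t \<ge> 0" for s t
      proof -
        have "r (x + y) \<le> h (x + y) (s + t)" using le that by simp
        also have "\<dots> \<le> h x s + h y t"
          using q_add[of "x + s *\<^sub>R v" "y + t *\<^sub>R v"] by (simp add: h_def algebra_simps)
        finally show ?thesis .
      qed
      then have "r (x + y) - h x s \<le> r y" if "s \<ge> 0" for s
        using that by (intro ge) (simp add: algebra_simps)
      then have "r (x + y) - r y \<le> r x"
        by (intro ge) (simp add: algebra_simps)
      then show "r (x + y) \<le> r x + r y" by simp
    next
      fix t :: real and x assume t: "t > 0"
      have "r (t *\<^sub>R x) / t \<le> r x"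
      proof (rule ge)
        fix s :: real assume s: "s \<ge> 0"
        have "r (t *\<^sub>R x) \<le> h (t *\<^sub>R x) (t * s)" using le s t by simp
        also have "\<dots> = t * h x s"
          using q_scale[OF t, of "x + s *\<^sub>R v"] by (simp add: h_def algebra_simps)
        finally show "r (t *\<^sub>R x) / t \<le> h x s" using t by (simp add: field_simps)
      qed
      then show "r (t *\<^sub>R x) \<le> t * r x" using t by (simp add: field_simps)
    next
      have "0 \<le> r 0" using h_lower[of _ 0] q_0 by (intro ge) auto
      moreover have "r 0 \<le> 0" using le[of 0 0] q_0 by (simp add: h_def)
      ultimately show "r 0 = 0" by linarith
    qed
    moreover have "r \<le> q" using le[of 0] by (auto simp: h_def le_fun_def)
    ultimately have "r = q" by (rule min)
    then show ?thesis using le[of 1 "- v"] q_0 by (simp add: h_def)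
  qed
  then have "linear q" using q(1) by (rule sublinear_odd_imp_linear[rotated])
  then show ?thesis using that q(2) by (auto simp: le_fun_def)
qed

text \<open>The functional to be extended is given by its graph \<open>Z\<close>; the bound makes it
  single-valued, since with \<open>(0, r)\<close> also \<open>(0, - r)\<close> lies in
  \<open>Z\<close>. The majorant is the infimum of \<open>M * norm (f - z) + r\<close> over the
  graph. A linear functional below it is at most \<open>M * norm f\<close>, by the pair
  \<open>(0, 0)\<close>, and takes the value \<open>r\<close> at \<open>z\<close>, because
  \<open>Z\<close> is symmetric.\<close>

lemma hahn_banach_graph:
  fixes Z :: "('a::real_normed_vector \<times> real) set"
  assumes Z: "subspace Z" and bound: "\<And>z r. (z, r) \<in> Z \<Longrightarrow> r \<le> M * norm z" and "M \<ge> 0"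
  obtains \<phi> :: "'a \<Rightarrow>\<^sub>L real" where "norm \<phi> \<le> M" "\<And>z r. (z, r) \<in> Z \<Longrightarrow> blinfun_apply \<phi> z = r"
proof -
  define h where "h = (\<lambda>(f::'a) zr. M * norm (f - fst zr) + snd zr :: real)"
  define p where "p = (\<lambda>f. INF zr\<in>Z. h f zr)"
  have Z0: "0 \<in> Z" and Zadd: "\<And>a b. a \<in> Z \<Longrightarrow> b \<in> Z \<Longrightarrow> a + b \<in> Z"
    and Zsc: "\<And>t a. a \<in> Z \<Longrightarrow> t *\<^sub>R a \<in> Z"
    using Z by (auto simp: subspace_def)
  have h_lower: "- M * norm f \<le> h f zr" if "zr \<in> Z" for f zr
  proof -
    have "- zr \<in> Z" using Zsc[OF that, of "-1"] by simp
    then have "- snd zr \<le> M * norm (fst zr)"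
      using bound[of "- fst zr" "- snd zr"] by (simp add: uminus_prod_def)
    moreover have "M * norm (fst zr) \<le> M * (norm (f - fst zr) + norm f)"
      using norm_triangle_ineq4[of f "f - fst zr"] \<open>M \<ge> 0\<close> by (intro mult_left_mono) auto
    ultimately show ?thesis by (simp add: h_def algebra_simps)
  qed
  have le: "p f \<le> h f zr" if "zr \<in> Z" for f zr
    unfolding p_def using that h_lower by (intro cINF_lower bdd_belowI2[where m = "- M * norm f"]) auto
  have ge: "m \<le> p f" if "\<And>zr. zr \<in> Z \<Longrightarrow> m \<le> h f zr" for m f
    unfolding p_def using that Z0 by (intro cINF_greatest) auto
  have "sublinear p"
  proof (rule sublinearI)
    fix f g
    have "p (f + g) \<le> h f a + h g b" if "a \<in> Z" "b \<in> Z" for a b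
    proof -
      have "p (f + g) \<le> h (f + g) (a + b)" using le Zadd that by simp
      also have "\<dots> \<le> h f a + h g b"
        using mult_left_mono[OF norm_triangle_ineq[of "f - fst a" "g - fst b"] \<open>M \<ge> 0\<close>]
        by (simp add: h_def algebra_simps)
      finally show ?thesis .
    qed
    then have "p (f + g) - h f a \<le> p g" if "a \<in> Z" for a
      using that by (intro ge) (simp add: algebra_simps)
    then have "p (f + g) - p g \<le> p f"
      by (intro ge) (simp add: algebra_simps)
    then show "p (f + g) \<le> p f + p g" by simp
  next
    fix t :: real and f assume t: "t > 0"
    have "p (t *\<^sub>R f) / t \<le> p f"
    proof (rule ge)
      fix a assume "a \<in> Z"
      then have "p (t *\<^sub>R f) \<le> h (t *\<^sub>R f) (t *\<^sub>R a)" using le Zsc by simp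
      also have "\<dots> = t * h f a"
        using t by (simp add: h_def algebra_simps flip: scaleR_diff_right)
      finally show "p (t *\<^sub>R f) / t \<le> h f a" using t by (simp add: field_simps)
    qed
    then show "p (t *\<^sub>R f) \<le> t * p f" using t by (simp add: field_simps)
  next
    have "0 \<le> p 0" using h_lower[of _ 0] by (intro ge) auto
    moreover have "p 0 \<le> 0" using le[OF Z0, of 0] by (simp add: h_def)
    ultimately show "p 0 = 0" by linarith
  qed
  then obtain g where g: "linear g" "\<And>f. g f \<le> p f"
    using hahn_banach_sublinear by blast
  have g_le: "g f \<le> M * norm f" for f
    using g(2)[of f] le[OF Z0, of f] by (simp add: h_def)
  have g_abs: "norm (g f) \<le> norm f * M" for f
    using g_le[of f] g_le[of "- f"] linear_neg[OF g(1), of f] by (simp add: abs_le_iff mult.commute)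
  have bl: "bounded_linear g"
    using g(1) g_abs by (auto simp: linear_conv_bounded_linear bounded_linear_def bounded_linear_axioms_def linear_iff)
  have apply_eq: "blinfun_apply (Blinfun g) = g"
    using bl by (rule bounded_linear_Blinfun_apply)
  show ?thesis
  proof
    show "norm (Blinfun g) \<le> M"
      using g_abs \<open>M \<ge> 0\<close> by (intro norm_blinfun_bound) (auto simp: apply_eq mult.commute)
    fix z r assume zr: "(z, r) \<in> Z"
    have "(- z, - r) \<in> Z" using Zsc[OF zr, of "-1"] by simp
    then have "g (- z) \<le> - r" using g(2)[of "- z"] le[of _ "- z"] by (fastforce simp: h_def)
    moreover have "g z \<le> r" using g(2)[of z] le[OF zr, of z] by (simp add: h_def)
    ultimately show "blinfun_apply (Blinfun g) z = r"
      using linear_neg[OF g(1), of z] by (simp add: apply_eq)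
  qed
qed

text \<open>Helly's condition. Since the coefficients may change sign, the one-sided inequality
  forces a combination of the \<open>c i\<close> to vanish whenever the same combination of the
  \<open>y i\<close> does, so the values are consistent on the span.\<close>

lemma hahn_banach_helly:
  fixes y :: "'i \<Rightarrow> 'a::real_normed_vector"
  assumes bound: "\<And>F a. finite F \<Longrightarrow> F \<subseteq> I \<Longrightarrow> (\<Sum>i\<in>F. a i * c i) \<le> M * norm (\<Sum>i\<in>F. a i *\<^sub>R y i)"
    and "M \<ge> 0"
  obtains \<phi> :: "'a \<Rightarrow>\<^sub>L real" where "norm \<phi> \<le> M" "\<And>i. i \<in> I \<Longrightarrow> blinfun_apply \<phi> (y i) = c i"
proof -
  define Z where "Z = {(\<Sum>i\<in>F. a i *\<^sub>R (y i, c i)) | F a. finite F \<and> F \<subseteq> I}"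
  have "subspace Z"
    unfolding subspace_def
  proof (intro conjI ballI allI)
    show "0 \<in> Z" unfolding Z_def by (rule CollectI, rule exI[of _ "{}"]) auto
  next
    fix u v assume "u \<in> Z" "v \<in> Z"
    then obtain F a G b where F: "finite F" "F \<subseteq> I" "u = (\<Sum>i\<in>F. a i *\<^sub>R (y i, c i))"
      and G: "finite G" "G \<subseteq> I" "v = (\<Sum>i\<in>G. b i *\<^sub>R (y i, c i))"
      unfolding Z_def by blast
    have "u = (\<Sum>i\<in>F \<union> G. (if i \<in> F then a i else 0) *\<^sub>R (y i, c i))"
      unfolding F(3) using F(1) G(1) by (intro sum.mono_neutral_cong_left) (auto simp: zero_prod_def)
    moreover have "v = (\<Sum>i\<in>F \<union> G. (if i \<in> G then b i else 0) *\<^sub>R (y i, c i))"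
      unfolding G(3) using F(1) G(1) by (intro sum.mono_neutral_cong_left) (auto simp: zero_prod_def)
    ultimately have "u + v = (\<Sum>i\<in>F \<union> G. ((if i \<in> F then a i else 0) + (if i \<in> G then b i else 0)) *\<^sub>R (y i, c i))"
      by (simp only: scaleR_add_left sum.distrib)
    then show "u + v \<in> Z" unfolding Z_def using F(1,2) G(1,2) by (intro CollectI exI[of _ "F \<union> G"] exI conjI) auto
  next
    fix t u assume "u \<in> Z"
    then obtain F a where F: "finite F" "F \<subseteq> I" "u = (\<Sum>i\<in>F. a i *\<^sub>R (y i, c i))"
      unfolding Z_def by blast
    have "t *\<^sub>R u = (\<Sum>i\<in>F. (t * a i) *\<^sub>R (y i, c i))"
      unfolding F(3) by (simp only: scaleR_sum_right scaleR_scaleR)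
    then show "t *\<^sub>R u \<in> Z" unfolding Z_def using F(1,2) by (intro CollectI exI[of _ F] exI conjI) auto
  qed
  moreover have "r \<le> M * norm z" if zr: "(z, r) \<in> Z" for z r
  proof -
    obtain F a where F: "finite F" "F \<subseteq> I" "(z, r) = (\<Sum>i\<in>F. a i *\<^sub>R (y i, c i))"
      using zr unfolding Z_def by blast
    have "z = (\<Sum>i\<in>F. a i *\<^sub>R y i)" "r = (\<Sum>i\<in>F. a i * c i)"
      using arg_cong[OF F(3), of fst] arg_cong[OF F(3), of snd] by (simp_all add: fst_sum snd_sum)
    then show ?thesis using bound[OF F(1,2)] by simp
  qed
  ultimately obtain \<phi> :: "'a \<Rightarrow>\<^sub>L real" where \<phi>: "norm \<phi> \<le> M" "\<And>z r. (z, r) \<in> Z \<Longrightarrow> blinfun_apply \<phi> z = r"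
    using hahn_banach_graph[of Z M] \<open>M \<ge> 0\<close> by metis
  have "(y i, c i) \<in> Z" if "i \<in> I" for i
    unfolding Z_def using that by (intro CollectI exI[of _ "{i}"] exI[of _ "\<lambda>_. 1"]) auto
  with \<phi> that show ?thesis by metis
qed

lemma norming_functional:
  fixes v :: "'a::real_normed_vector"
  obtains \<phi> :: "'a \<Rightarrow>\<^sub>L real" where "norm \<phi> \<le> 1" "blinfun_apply \<phi> v = norm v"
proof -
  have "(\<Sum>i\<in>F. a i * norm v) \<le> 1 * norm (\<Sum>i\<in>F. a i *\<^sub>R v)" for F and a :: "unit \<Rightarrow> real"
    by (simp add: mult_right_mono flip: sum_distrib_right scaleR_sum_left)
  from hahn_banach_helly[of UNIV "\<lambda>_. norm v" 1 "\<lambda>_::unit. v", OF this] that show ?thesis by auto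
qed

text \<open>With \<open>d\<close> the distance of \<open>x\<close> from \<open>S\<close>, the
  functional sends \<open>s + t *\<^sub>R x\<close> to \<open>t * d\<close>. For
  \<open>t > 0\<close>, dividing by \<open>t\<close> shows that the vector has norm at least
  \<open>t * d\<close>; otherwise the one-sided bound is trivial.\<close>

lemma hahn_banach_separation:
  fixes S :: "'a::real_normed_vector set"
  assumes S: "subspace S" "closed S" and x: "x \<notin> S"
  obtains \<phi> :: "'a \<Rightarrow>\<^sub>L real" where "blinfun_apply \<phi> x \<noteq> 0" "\<And>s. s \<in> S \<Longrightarrow> blinfun_apply \<phi> s = 0"
proof -
  define d where "d = infdist x S"
  have S0: "0 \<in> S" using S subspace_0 by blast
  have d: "d > 0"
    using in_closed_iff_infdist_zero[OF S(2), of x] S0 x infdist_nonneg[of x S] by (auto simp: d_def less_le)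
  define Z where "Z = {(s + t *\<^sub>R x, t * d) | s t. s \<in> S}"
  have "subspace Z"
    unfolding subspace_def
  proof (intro conjI ballI allI)
    show "0 \<in> Z" unfolding Z_def zero_prod_def using S0 by (intro CollectI exI[of _ 0]) auto
  next
    fix u v assume "u \<in> Z" "v \<in> Z"
    then obtain s t s' t' where "s \<in> S" "u = (s + t *\<^sub>R x, t * d)" "s' \<in> S" "v = (s' + t' *\<^sub>R x, t' * d)"
      unfolding Z_def by blast
    then have "s + s' \<in> S" "u + v = ((s + s') + (t + t') *\<^sub>R x, (t + t') * d)"
      using S(1) by (auto simp: algebra_simps subspace_add)
    then show "u + v \<in> Z" unfolding Z_def by blast
  next
    fix c u assume "u \<in> Z"
    then obtain s t where "s \<in> S" "u = (s + t *\<^sub>R x, t * d)"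
      unfolding Z_def by blast
    then have "c *\<^sub>R s \<in> S" "c *\<^sub>R u = (c *\<^sub>R s + (c * t) *\<^sub>R x, (c * t) * d)"
      using S(1) by (auto simp: algebra_simps subspace_scale)
    then show "c *\<^sub>R u \<in> Z" unfolding Z_def by blast
  qed
  moreover have "r \<le> 1 * norm z" if "(z, r) \<in> Z" for z r
  proof -
    obtain s t where s: "s \<in> S" "z = s + t *\<^sub>R x" "r = t * d" using \<open>(z, r) \<in> Z\<close> unfolding Z_def by blast
    show ?thesis
    proof (cases "t > 0")
      case True
      have "(- 1 / t) *\<^sub>R s \<in> S" using s(1) S(1) subspace_scale by blast
      then have "d \<le> dist x ((- 1 / t) *\<^sub>R s)" unfolding d_def by (rule infdist_le)
      also have "\<dots> = norm ((1 / t) *\<^sub>R z)" using True by (simp add: dist_norm s(2) algebra_simps)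
      also have "\<dots> = norm z / t" using True by simp
      finally show ?thesis using True by (simp add: s(3) field_simps)
    next
      case False
      then have "r \<le> 0" using d by (simp add: s(3) mult_nonpos_nonneg)
      then show ?thesis using norm_ge_zero[of z] by linarith
    qed
  qed
  ultimately obtain \<phi> :: "'a \<Rightarrow>\<^sub>L real" where \<phi>: "\<And>z r. (z, r) \<in> Z \<Longrightarrow> blinfun_apply \<phi> z = r"
    using hahn_banach_graph[of Z 1] by (metis zero_le_one)
  have "(x, d) \<in> Z" unfolding Z_def using S0 by (intro CollectI exI[of _ 0] exI[of _ 1]) auto
  moreover have "(s, 0) \<in> Z" if "s \<in> S" for s
    unfolding Z_def using that by (intro CollectI exI[of _ s] exI[of _ 0]) auto
  ultimately show ?thesis using that[of \<phi>] \<phi> d by (metis less_irrefl)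
qed

section \<open>Simons' inequality and limits on dense subspaces\<close>

text \<open>The weights 1/2, ..., 1/2^N and the leftover 1/2^N add up to 1. The induction runs over
  all \<open>s\<close>, so that the last two points can be merged into their midpoint.\<close>

lemma dyadic_partial_convex:
  fixes S :: "'a::real_vector set"
  assumes S: "convex S" and y: "\<And>k. y k \<in> S" and s: "s \<in> S"
  shows "(\<Sum>k<N. (1/2)^(k+1) *\<^sub>R y k) + (1/2)^N *\<^sub>R s \<in> S"
  using s
proof (induction N arbitrary: s)
  case 0
  then show ?case by simp
next
  case (Suc N)
  have "(1/2) *\<^sub>R y N + (1/2) *\<^sub>R s \<in> S"
    using S y Suc.prems by (intro convexD) auto
  from Suc.IH[OF this] show ?case by (simp add: algebra_simps)
qed

lemma dyadic_sums_bounded: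
  fixes y :: "nat \<Rightarrow> 'a::banach"
  assumes "\<And>k. norm (y k) \<le> K"
  shows "summable (\<lambda>k. (1/2)^(k+1) *\<^sub>R y k)"
proof (rule summable_comparison_test')
  show "summable (\<lambda>k. K * (1/2)^(k+1))"
    by (intro summable_mult summable_ignore_initial_segment summable_geometric) auto
  show "norm ((1/2)^(k+1) *\<^sub>R y k) \<le> K * (1/2)^(k+1)" for k
    using assms[of k] by (simp add: field_simps)
qed

lemma dyadic_suminf_convex:
  fixes S :: "'a::banach set"
  assumes S: "convex S" "closed S" and y: "\<And>k. y k \<in> S" and bdd: "\<And>k. norm (y k) \<le> K"
  shows "(\<Sum>k. (1/2)^(k+1) *\<^sub>R y k) \<in> S"
proof (rule closed_sequentially[OF S(2)])
  show "(\<Sum>k<N. (1/2)^(k+1) *\<^sub>R y k) + (1/2)^N *\<^sub>R y 0 \<in> S" for N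
    by (intro dyadic_partial_convex S y)
  have "(\<lambda>N. (1/2)^N *\<^sub>R y 0) \<longlonglongrightarrow> 0 *\<^sub>R y 0"
    by (intro tendsto_intros LIMSEQ_realpow_zero) auto
  from tendsto_add[OF summable_LIMSEQ[OF dyadic_sums_bounded[OF bdd]] this]
  show "(\<lambda>N. (\<Sum>k<N. (1/2)^(k+1) *\<^sub>R y k) + (1/2)^N *\<^sub>R y 0)
      \<longlonglongrightarrow> (\<Sum>k. (1/2)^(k+1) *\<^sub>R y k)"
    by simp
qed

text \<open>Simons' inequality. The vectors \<open>y n\<close> almost minimise \<open>norm (z n + y / 2^(n+1))\<close> over the
  closed convex hull of the \<open>n\<close>-th tail, so an element of the boundary that norms the limit of
  \<open>z n\<close> is bounded away from \<open>0\<close> on every such hull.\<close>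
lemma simons_contradiction:
  fixes u :: "nat \<Rightarrow> 'a::banach" and f :: "'a \<Rightarrow>\<^sub>L real"
  assumes norming: "\<And>w. \<exists>b\<in>B. norm b \<le> 1 \<and> blinfun_apply b w = norm w"
    and bdd: "\<And>k. norm (u k) \<le> K"
    and null: "\<And>b. b \<in> B \<Longrightarrow> (\<lambda>k. blinfun_apply b (u k)) \<longlonglongrightarrow> 0"
    and "\<eta> > 0" and f: "\<And>k. blinfun_apply f (u k) \<ge> \<eta>"
  shows False
proof -
  define H where "H = (\<lambda>n. closure (convex hull (u ` {n..})))"
  have H_subset: "H n \<subseteq> S" if "closed S" "convex S" "\<And>k. k \<ge> n \<Longrightarrow> u k \<in> S" for n S
    unfolding H_def using that by (intro closure_minimal hull_minimal) auto
  have H_closed: "closed (H n)" and H_convex: "convex (H n)" for n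
    by (auto simp: H_def intro: convex_closure)
  have u_H: "u n \<in> H n" for n
    unfolding H_def by (meson atLeast_iff closure_subset hull_inc image_eqI le_refl subsetD)
  have H_anti: "H n \<subseteq> H m" if "m \<le> n" for m n
    unfolding H_def using that by (intro closure_mono hull_mono image_mono) auto
  have H_bdd: "norm y \<le> K" if "y \<in> H n" for y n
    using H_subset[of "cball 0 K" n] that bdd by auto
  have f_pos: "norm f > 0"
    using f[of 0] \<open>\<eta> > 0\<close> by (auto simp: zero_less_norm_iff)
  \<comment> \<open>Elements of \<open>H 0\<close> have norm at least
    \<open>\<eta> / norm f\<close>, which is twice \<open>\<delta>\<close>. One half will pay for
    the errors of the minimisation; the other half survives.\<close>
  define \<delta> where "\<delta> = \<eta> / norm f / 2"
  have "\<delta> > 0" using \<open>\<eta> > 0\<close> f_pos by (simp add: \<delta>_def)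
  have H_lower: "norm y \<ge> 2 * \<delta>" if "y \<in> H 0" for y
  proof -
    have "H 0 \<subseteq> {y. \<eta> \<le> blinfun_apply f y}"
    proof (rule H_subset)
      show "closed {y. \<eta> \<le> blinfun_apply f y}" by (intro closed_Collect_le continuous_intros)
      have "{y. \<eta> \<le> blinfun_apply f y} = blinfun_apply f -` {\<eta>..}" by auto
      then show "convex {y. \<eta> \<le> blinfun_apply f y}"
        by (simp add: convex_linear_vimage bounded_linear.linear blinfun.bounded_linear_right)
    qed (use f in auto)
    then have "\<eta> \<le> norm (blinfun_apply f y)" using that by force
    then have "\<eta> \<le> norm f * norm y" using norm_blinfun[of f y] by linarith
    then show ?thesis using f_pos by (simp add: \<delta>_def field_simps)
  qed
  \<comment> \<open>The error has the factor \<open>(1/4)^(n+1)\<close> because it will be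
    multiplied by \<open>2^(n+1)\<close>; the products are then geometric with sum at most
    \<open>\<delta>\<close>.\<close>
  have "\<exists>y\<in>H n. \<forall>y'\<in>H n. norm (z + (1/2)^(n+1) *\<^sub>R y) \<le> norm (z + (1/2)^(n+1) *\<^sub>R y') + \<delta> * (1/4)^(n+1)"
    for n z
  proof -
    define m where "m = (INF y\<in>H n. norm (z + (1/2)^(n+1) *\<^sub>R y))"
    have bb: "bdd_below ((\<lambda>y. norm (z + (1/2)^(n+1) *\<^sub>R y)) ` H n)"
      by (intro bdd_belowI2[where m = 0]) auto
    have "m < m + \<delta> * (1/4)^(n+1)" using \<open>\<delta> > 0\<close> by simp
    then obtain y where "y \<in> H n" "norm (z + (1/2)^(n+1) *\<^sub>R y) < m + \<delta> * (1/4)^(n+1)"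
      unfolding m_def using cINF_less_iff[OF _ bb] u_H by blast
    moreover have "m \<le> norm (z + (1/2)^(n+1) *\<^sub>R y')" if "y' \<in> H n" for y'
      unfolding m_def by (intro cINF_lower bb that)
    ultimately show ?thesis by force
  qed
  then obtain Y where Y_H: "\<And>n z. Y n z \<in> H n"
    and Y_min: "\<And>n z y'. y' \<in> H n \<Longrightarrow>
        norm (z + (1/2)^(n+1) *\<^sub>R Y n z) \<le> norm (z + (1/2)^(n+1) *\<^sub>R y') + \<delta> * (1/4)^(n+1)"
    by metis
  define z where "z = rec_nat 0 (\<lambda>n z. z + (1/2)^(n+1) *\<^sub>R Y n z)"
  define y where "y = (\<lambda>n. Y n (z n))"
  have z_0: "z 0 = 0" and z_Suc: "z (Suc n) = z n + (1/2)^(n+1) *\<^sub>R y n" for n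
    by (simp_all add: z_def y_def)
  have z_sum: "z n = (\<Sum>k<n. (1/2)^(k+1) *\<^sub>R y k)" for n
    by (induction n) (simp_all add: z_0 z_Suc)
  have y_H: "y k \<in> H n" if "n \<le> k" for n k
    using Y_H H_anti[OF that] by (auto simp: y_def)
  have y_bdd: "norm (y k) \<le> K" for k using H_bdd y_H by blast
  define t where "t = (\<lambda>n. \<Sum>k. (1/2)^(k+1) *\<^sub>R y (n + k))"
  have t_H: "t n \<in> H n" for n
    unfolding t_def using H_convex H_closed y_H y_bdd by (intro dyadic_suminf_convex) auto
  define Z where "Z = t 0"
  have Z_split: "Z = z n + (1/2)^n *\<^sub>R t n" for n
  proof -
    have "Z = (\<Sum>k. (1/2)^(k+n+1) *\<^sub>R y (k + n)) + z n"
      unfolding Z_def t_def z_sum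
      using suminf_split_initial_segment[OF dyadic_sums_bounded[of y, OF y_bdd], of n] by simp
    also have "(\<lambda>k. (1/2::real)^(k+n+1) *\<^sub>R y (k + n)) = (\<lambda>k. (1/2)^n *\<^sub>R ((1/2)^(k+1) *\<^sub>R y (n + k)))"
      by (auto simp: power_add add.commute mult.commute)
    also have "(\<Sum>k. (1/2::real)^n *\<^sub>R ((1/2)^(k+1) *\<^sub>R y (n + k))) = (1/2)^n *\<^sub>R t n"
      unfolding t_def using dyadic_sums_bounded[of "\<lambda>k. y (n + k)", OF y_bdd] by (rule suminf_scaleR_right[symmetric])
    finally show ?thesis by simp
  qed
  \<comment> \<open>The tail average \<open>t n\<close> lies in \<open>H n\<close> and competes with
    \<open>y n\<close>. It leads to \<open>z n + (1/2)^(n+1) *\<^sub>R t n\<close>, which is the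
    midpoint of \<open>z n\<close> and \<open>Z\<close>.\<close>
  have step: "norm (z (Suc n)) \<le> norm Z / 2 + norm (z n) / 2 + \<delta> * (1/4)^(n+1)" for n
  proof -
    have "norm (z (Suc n)) \<le> norm (z n + (1/2)^(n+1) *\<^sub>R t n) + \<delta> * (1/4)^(n+1)"
      using Y_min[where n = n and z = "z n", OF t_H] by (simp add: z_Suc y_def)
    also have "z n + (1/2)^(n+1) *\<^sub>R t n = (1/2) *\<^sub>R Z + (1/2) *\<^sub>R z n"
      using scaleR_left.add[of "1/2" "1/2" "z n"] by (simp add: Z_split[of n] algebra_simps)
    also have "norm \<dots> \<le> norm Z / 2 + norm (z n) / 2"
      using norm_triangle_ineq[of "(1/2) *\<^sub>R Z" "(1/2) *\<^sub>R z n"] by simp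
    finally show ?thesis by simp
  qed
  \<comment> \<open>\<open>step\<close> halves the difference of the norms, so multiplying by
    \<open>2^n\<close> makes the recursion telescope.\<close>
  have gap: "2^n * (norm (z n) - norm Z) \<le> - norm Z + \<delta> * (1 - (1/2)^n)" for n
  proof (induction n)
    case 0
    then show ?case by (simp add: z_0)
  next
    case (Suc n)
    have "2^Suc n * (norm (z (Suc n)) - norm Z) \<le> 2^Suc n * (norm (z n) / 2 - norm Z / 2 + \<delta> * (1/4)^(n+1))"
      using step[of n] by (intro mult_left_mono) auto
    also have "\<dots> = 2^n * (norm (z n) - norm Z) + \<delta> * (2^Suc n * (1/4)^(n+1))"
      by (simp add: algebra_simps)
    also have "(2::real)^Suc n * (1/4)^(n+1) = (1/2)^(n+1)"
      by (simp add: field_simps flip: power_mult_distrib)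
    finally show ?case using Suc.IH by (simp add: algebra_simps)
  qed
  obtain b where b: "b \<in> B" "norm b \<le> 1" "blinfun_apply b Z = norm Z"
    using norming by blast
  \<comment> \<open>As \<open>b\<close> norms \<open>Z\<close>, its value at \<open>t n\<close> is
    \<open>2^n * (norm Z - b (z n))\<close>. By \<open>gap\<close> this is at least
    \<open>norm Z - \<delta>\<close>, hence at least \<open>\<delta>\<close>.\<close>
  have b_t: "blinfun_apply b (t n) \<ge> \<delta>" for n
  proof -
    have "blinfun_apply b (z n) \<le> norm (z n)"
      using norm_blinfun[of b "z n"] mult_right_mono[OF b(2), of "norm (z n)"] by simp
    then have "2^n * (norm Z - norm (z n)) \<le> 2^n * (norm Z - blinfun_apply b (z n))"
      by (intro mult_left_mono) auto
    also have "\<dots> = blinfun_apply b (t n)"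
      using Z_split[of n] b(3) by (simp add: blinfun.add_right blinfun.scaleR_right field_simps)
    finally have "2^n * (norm Z - norm (z n)) \<le> blinfun_apply b (t n)" .
    moreover have "2^n * (norm Z - norm (z n)) \<ge> norm Z - \<delta>"
    proof -
      have "\<delta> * (1 - (1/2)^n) \<le> \<delta> * 1" using \<open>\<delta> > 0\<close> by (intro mult_left_mono) auto
      then show ?thesis using gap[of n] by (simp add: algebra_simps)
    qed
    moreover have "norm Z \<ge> 2 * \<delta>" using H_lower t_H by (simp add: Z_def)
    ultimately show ?thesis by linarith
  qed
  have "\<forall>\<^sub>F k in sequentially. blinfun_apply b (u k) < \<delta> / 2"
    using null[OF b(1)] \<open>\<delta> > 0\<close> by (intro order_tendstoD(2)) auto
  then obtain n where n: "\<And>k. k \<ge> n \<Longrightarrow> blinfun_apply b (u k) < \<delta> / 2"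
    by (auto simp: eventually_sequentially)
  have "H n \<subseteq> {y. blinfun_apply b y \<le> \<delta> / 2}"
  proof (rule H_subset)
    show "closed {y. blinfun_apply b y \<le> \<delta> / 2}" by (intro closed_Collect_le continuous_intros)
    have "{y. blinfun_apply b y \<le> \<delta> / 2} = blinfun_apply b -` {..\<delta> / 2}" by auto
    then show "convex {y. blinfun_apply b y \<le> \<delta> / 2}"
      by (simp add: convex_linear_vimage bounded_linear.linear blinfun.bounded_linear_right)
  qed (use n in force)
  then have "blinfun_apply b (t n) \<le> \<delta> / 2" using t_H by auto
  with b_t[of n] \<open>\<delta> > 0\<close> show False by linarith
qed

text \<open>A Rainwater theorem for boundaries: if the values of \<open>f\<close> did not tend to 0,
  then \<open>f\<close> or \<open>- f\<close> would stay above some \<open>\<eta> > 0\<close> along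
  a subsequence, which Simons' inequality excludes.\<close>

lemma boundary_null_imp_weakly_null:
  fixes u :: "nat \<Rightarrow> 'a::banach" and f :: "'a \<Rightarrow>\<^sub>L real"
  assumes norming: "\<And>w. \<exists>b\<in>B. norm b \<le> 1 \<and> blinfun_apply b w = norm w"
    and bdd: "\<And>k. norm (u k) \<le> K"
    and null: "\<And>b. b \<in> B \<Longrightarrow> (\<lambda>k. blinfun_apply b (u k)) \<longlonglongrightarrow> 0"
  shows "(\<lambda>k. blinfun_apply f (u k)) \<longlonglongrightarrow> 0"
proof -
  have ev: "\<forall>\<^sub>F k in sequentially. blinfun_apply g (u k) < \<eta>" if "\<eta> > 0" for \<eta> and g :: "'a \<Rightarrow>\<^sub>L real"
  proof (rule ccontr)
    assume "\<not> ?thesis"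
    then obtain r :: "nat \<Rightarrow> nat" where r: "strict_mono r" "\<And>k. \<not> blinfun_apply g (u (r k)) < \<eta>"
      using not_eventually_sequentiallyD by blast
    show False
    proof (rule simons_contradiction[OF norming])
      show "norm (u (r k)) \<le> K" for k by (rule bdd)
      show "(\<lambda>k. blinfun_apply b (u (r k))) \<longlonglongrightarrow> 0" if "b \<in> B" for b
        using LIMSEQ_subseq_LIMSEQ[OF null[OF that] r(1)] by (simp add: o_def)
      show "\<eta> > 0" by fact
      show "\<eta> \<le> blinfun_apply g (u (r k))" for k using r(2)[of k] by linarith
    qed
  qed
  show ?thesis
  proof (rule order_tendstoI)
    show "\<forall>\<^sub>F k in sequentially. blinfun_apply f (u k) < a" if "0 < a" for a
      using ev[OF that] .
    show "\<forall>\<^sub>F k in sequentially. a < blinfun_apply f (u k)" if "a < 0" for a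
      using ev[of "- a" "- f"] that by (simp add: uminus_blinfun.rep_eq)
  qed
qed

text \<open>Linearity carries the convergence to the span, the common bound 1 to its closure. This
  serves for the adjoint projections on the dual of V, the basis projections on W, and weak-star
  limits of the functionals \<open>bfun\<close>.\<close>

lemma tendsto_on_dense_span:
  fixes T :: "nat \<Rightarrow> 'a::real_normed_vector \<Rightarrow> 'b::real_normed_vector"
  assumes lin: "\<And>k. linear (T k)" "linear L"
    and bound: "\<And>k w. norm (T k w) \<le> norm w" "\<And>w. norm (L w) \<le> norm w"
    and conv: "\<And>d. d \<in> D \<Longrightarrow> (\<lambda>k. T k d) \<longlonglongrightarrow> L d"
    and dense: "closure (span D) = UNIV"
  shows "(\<lambda>k. T k w) \<longlonglongrightarrow> L w"
proof -
  have span: "(\<lambda>k. T k d) \<longlonglongrightarrow> L d" if "d \<in> span D" for d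
    using that
  proof (induction rule: span_induct_alt)
    case base
    then show ?case by (simp add: linear_0 lin)
  next
    case (step c x y)
    then show ?case using conv by (auto simp: linear_add linear_scale lin intro!: tendsto_intros)
  qed
  show ?thesis
  proof (rule LIMSEQ_I)
    fix r :: real assume "r > 0"
    then obtain d where d: "d \<in> span D" "dist d w < r / 3"
      using dense closure_approachable[of w "span D"] by (metis UNIV_I divide_pos_pos zero_less_numeral)
    obtain N where N: "\<And>k. k \<ge> N \<Longrightarrow> norm (T k d - L d) < r / 3"
      using LIMSEQ_D[OF span[OF d(1)], of "r / 3"] \<open>r > 0\<close> by auto
    have "norm (T k w - L w) < r" if "k \<ge> N" for k
    proof -
      have "T k w - L w = T k (w - d) + (T k d - L d) - L (w - d)"
        by (simp add: linear_diff lin)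
      also have "norm \<dots> \<le> norm (T k (w - d)) + norm (T k d - L d) + norm (L (w - d))"
        by norm
      also have "\<dots> < r"
        using bound(1)[of k "w - d"] bound(2)[of "w - d"] N[OF that] d(2)
        by (simp add: dist_norm norm_minus_commute)
      finally show ?thesis .
    qed
    then show "\<exists>no. \<forall>k\<ge>no. norm (T k w - L w) < r" by blast
  qed
qed

lemma blinfun_eq_on_dense_span:
  fixes f g :: "'a::real_normed_vector \<Rightarrow>\<^sub>L real"
  assumes "closure (span D) = UNIV" and eq: "\<And>d. d \<in> D \<Longrightarrow> blinfun_apply f d = blinfun_apply g d"
  shows "f = g"
proof -
  have "span D \<subseteq> {w. blinfun_apply f w = blinfun_apply g w}"
    by (intro span_minimal) (auto simp: eq subspace_def blinfun.add_right blinfun.scaleR_right blinfun.zero_right)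
  moreover have "closed {w. blinfun_apply f w = blinfun_apply g w}"
    by (intro closed_Collect_eq continuous_intros)
  ultimately have "closure (span D) \<subseteq> {w. blinfun_apply f w = blinfun_apply g w}"
    by (rule closure_minimal)
  then show ?thesis using assms(1) by (intro blinfun_eqI) auto
qed

lemma subspace_closure:
  fixes S :: "'a::real_normed_vector set"
  assumes "subspace S"
  shows "subspace (closure S)"
  unfolding subspace_def
proof (intro conjI ballI allI)
  show "0 \<in> closure S" using assms closure_subset subspace_0 by blast
  show "u + v \<in> closure S" if uv: "u \<in> closure S" "v \<in> closure S" for u v
  proof -
    obtain f g where "\<forall>n. f n \<in> S" "f \<longlonglongrightarrow> u" "\<forall>n. g n \<in> S" "g \<longlonglongrightarrow> v"
      using uv by (auto simp: closure_sequential)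
    then have "\<forall>n. f n + g n \<in> S" "(\<lambda>n. f n + g n) \<longlonglongrightarrow> u + v"
      using assms by (auto intro: subspace_add tendsto_add)
    then show ?thesis unfolding closure_sequential by (intro exI[of _ "\<lambda>n. f n + g n"] conjI)
  qed
  show "t *\<^sub>R u \<in> closure S" if u: "u \<in> closure S" for t u
  proof -
    obtain f where "\<forall>n. f n \<in> S" "f \<longlonglongrightarrow> u"
      using u by (auto simp: closure_sequential)
    then have "\<forall>n. t *\<^sub>R f n \<in> S" "(\<lambda>n. t *\<^sub>R f n) \<longlonglongrightarrow> t *\<^sub>R u"
      using assms by (auto intro: subspace_scale tendsto_scaleR[OF tendsto_const])
    then show ?thesis unfolding closure_sequential by (intro exI[of _ "\<lambda>n. t *\<^sub>R f n"] conjI)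
  qed
qed

text \<open>The factor 1/2 stands in for norm attainment, which may fail; it costs a factor 2 in
  \<open>shrinking_basis_e\<close>.\<close>

lemma blinfun_almost_norming:
  fixes f :: "'a::real_normed_vector \<Rightarrow>\<^sub>L real"
  shows "\<exists>w. norm w \<le> 1 \<and> norm f / 2 \<le> \<bar>blinfun_apply f w\<bar>"
proof (rule ccontr)
  assume "\<not> ?thesis"
  then have less: "\<bar>blinfun_apply f w\<bar> < norm f / 2" if "norm w \<le> 1" for w using that by force
  have "norm f \<le> norm f / 2"
  proof (rule norm_blinfun_bound)
    fix w
    show "norm (blinfun_apply f w) \<le> norm f / 2 * norm w"
    proof (cases "w = 0")
      case False
      then have "\<bar>blinfun_apply f ((1 / norm w) *\<^sub>R w)\<bar> < norm f / 2" by (intro less) simp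
      then show ?thesis using False by (simp add: blinfun.scaleR_right abs_mult field_simps)
    qed (simp add: blinfun.zero_right)
  qed simp
  then show False using less[of 0] by (simp add: blinfun.zero_right)
qed

section \<open>Bimonotone decompositions and admissible pairs\<close>

locale bimonotone_fdd =
  fixes V :: "nat \<Rightarrow> 'v::banach set"
  assumes FDD: "is_FDD V" and bimonotone: "bimonotone_FDD V"
begin

abbreviation proj :: "nat set \<Rightarrow> 'v \<Rightarrow> 'v" where
  "proj A v \<equiv> \<Sum>n\<in>A. coord V n v"

lemma subspace_comp: "subspace (V n)"
  using FDD by (simp add: is_FDD_def)

lemma coord_mem_sums: "(\<forall>j. coord V j v \<in> V j) \<and> (\<lambda>j. coord V j v) sums v"
proof -
  have "\<exists>!u. (\<forall>j. u j \<in> V j) \<and> u sums v" using FDD by (simp add: is_FDD_def)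
  from theI'[OF this] show ?thesis unfolding coord_def by simp
qed

lemma coord_mem: "coord V j v \<in> V j" and coord_sums: "(\<lambda>j. coord V j v) sums v"
  using coord_mem_sums by auto

lemma coord_unique: "(\<And>j. u j \<in> V j) \<Longrightarrow> u sums v \<Longrightarrow> coord V j v = u j"
proof -
  assume "\<And>j. u j \<in> V j" "u sums v"
  moreover have "\<exists>!u. (\<forall>j. u j \<in> V j) \<and> u sums v" using FDD by (simp add: is_FDD_def)
  ultimately have "(THE u. (\<forall>j. u j \<in> V j) \<and> u sums v) = u"
    by (intro the1_equality) simp_all
  then show ?thesis unfolding coord_def by simp
qed

lemma proj_tendsto: "(\<lambda>N. proj {..<N} v) \<longlonglongrightarrow> v"
  using coord_sums by (simp add: sums_def)

lemma linear_coord: "linear (coord V n)"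
proof
  show "coord V n (u + v) = coord V n u + coord V n v" for u v
    by (rule coord_unique[of "\<lambda>n. coord V n u + coord V n v"])
      (intro subspace_add[OF subspace_comp] coord_mem sums_add coord_sums)+
  show "coord V n (t *\<^sub>R v) = t *\<^sub>R coord V n v" for t v
    by (rule coord_unique[of "\<lambda>n. t *\<^sub>R coord V n v"])
      (intro subspace_scale[OF subspace_comp] coord_mem sums_scaleR_right coord_sums)+
qed

lemma coord_proj: "finite A \<Longrightarrow> coord V m (proj A v) = (if m \<in> A then coord V m v else 0)"
proof (rule coord_unique[of "\<lambda>m. if m \<in> A then coord V m v else 0"])
  show "(if j \<in> A then coord V j v else 0) \<in> V j" for j
    using coord_mem subspace_0[OF subspace_comp] by auto
  show "finite A \<Longrightarrow> (\<lambda>j. if j \<in> A then coord V j v else 0) sums proj A v"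
    by (rule sums_If_finite_set)
qed

lemma linear_proj: "linear (proj A)"
proof
  show "proj A (u + v) = proj A u + proj A v" for u v
    by (simp only: linear_add[OF linear_coord] sum.distrib)
  show "proj A (t *\<^sub>R v) = t *\<^sub>R proj A v" for t v
    by (simp only: linear_scale[OF linear_coord] scaleR_sum_right)
qed

lemma norm_proj_le: "norm (proj {p..<q} v) \<le> norm v"
proof (cases "p < q")
  case True
  have "norm (proj {p..<q} v) \<le> norm (proj {..<N} v)" if "N \<ge> q" for N
  proof -
    have "norm (\<Sum>j\<in>{p..q - 1}. coord V j v) \<le> norm (proj {..<N} v)"
      using bimonotone[unfolded bimonotone_FDD_def, rule_format, of "\<lambda>j. coord V j v" p "q - 1" N]
        coord_mem True that by auto
    moreover have "{p..q - 1} = {p..<q}" using True by auto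
    ultimately show ?thesis by simp
  qed
  then show ?thesis
    by (intro LIMSEQ_le_const[OF tendsto_norm[OF proj_tendsto]]) blast
qed simp

lemma norm_proj_lessThan_le: "norm (proj {..<q} v) \<le> norm v"
  using norm_proj_le[of v 0 q] by (simp add: atLeast0LessThan)

lemma bounded_linear_proj: "bounded_linear (proj {p..<q})"
proof (rule bounded_linear_intro[where K = 1])
  show "proj {p..<q} (u + v) = proj {p..<q} u + proj {p..<q} v" for u v
    by (rule linear_add[OF linear_proj])
  show "proj {p..<q} (t *\<^sub>R v) = t *\<^sub>R proj {p..<q} v" for t v
    by (rule linear_scale[OF linear_proj])
  show "norm (proj {p..<q} v) \<le> norm v * 1" for v
    using norm_proj_le by simp
qed

lemma proj_diff: "p \<le> q \<Longrightarrow> proj {p..<q} v = proj {..<q} v - proj {..<p} v"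
  using sum.atLeastLessThan_concat[of 0 p q "\<lambda>n. coord V n v"] by (simp add: atLeast0LessThan algebra_simps)

lemma proj_block_small:
  assumes "\<epsilon> > 0"
  obtains N where "\<And>p q. N \<le> p \<Longrightarrow> p \<le> q \<Longrightarrow> norm (proj {p..<q} v) < \<epsilon>"
proof -
  have "Cauchy (\<lambda>N. proj {..<N} v)" using proj_tendsto LIMSEQ_imp_Cauchy by blast
  from CauchyD[OF this assms] obtain N
    where "\<And>m n. m \<ge> N \<Longrightarrow> n \<ge> N \<Longrightarrow> norm (proj {..<m} v - proj {..<n} v) < \<epsilon>" by blast
  then have "norm (proj {p..<q} v) < \<epsilon>" if "N \<le> p" "p \<le> q" for p q
    using that by (simp add: proj_diff)
  then show ?thesis by (rule that)
qed

definition proj_blinfun :: "nat \<Rightarrow> 'v \<Rightarrow>\<^sub>L 'v" where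
  "proj_blinfun N = Blinfun (proj {0..<N})"

lemma proj_blinfun_apply: "blinfun_apply (proj_blinfun N) v = proj {..<N} v"
  unfolding proj_blinfun_def
  using bounded_linear_Blinfun_apply[OF bounded_linear_proj, of 0 N] by (simp add: atLeast0LessThan)

lemma norm_proj_blinfun: "norm (proj_blinfun N) \<le> 1"
  by (rule norm_blinfun_bound) (simp_all add: proj_blinfun_apply norm_proj_lessThan_le)

lemma dual_comp_apply: "f \<in> dual_comp V n \<Longrightarrow> blinfun_apply f (coord V n v) = blinfun_apply f v"
  by (simp add: dual_comp_def)

lemma dual_comp_proj:
  "f \<in> dual_comp V n \<Longrightarrow> finite A \<Longrightarrow>
     blinfun_apply f (proj A v) = (if n \<in> A then blinfun_apply f v else 0)"
  by (metis blinfun.zero_right coord_proj dual_comp_apply)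

text \<open>Bimonotonicity makes each single coordinate projection a contraction, so pulling
  \<open>f\<close> back along it does not increase the norm.\<close>

lemma coord_compose_dual_comp:
  fixes f :: "'v \<Rightarrow>\<^sub>L real"
  obtains g where "g \<in> dual_comp V n" "norm g \<le> norm f" "\<And>v. blinfun_apply g v = blinfun_apply f (coord V n v)"
proof -
  have bl: "bounded_linear (coord V n)" using bounded_linear_proj[of n "Suc n"] by simp
  define g where "g = f o\<^sub>L Blinfun (coord V n)"
  have g: "blinfun_apply g v = blinfun_apply f (coord V n v)" for v
    by (simp add: g_def bounded_linear_Blinfun_apply[OF bl])
  have "norm g \<le> norm f"
  proof (rule norm_blinfun_bound)
    show "norm (blinfun_apply g v) \<le> norm f * norm v" for v
      using norm_blinfun[of f "coord V n v"] mult_left_mono[OF norm_proj_le[of v n "Suc n"], of "norm f"]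
      by (simp add: g)
  qed simp
  moreover have "coord V n (coord V n v) = coord V n v" for v
    using coord_proj[where A = "{n}" and m = n and v = v] by simp
  then have "g \<in> dual_comp V n" by (simp add: dual_comp_def g)
  ultimately show ?thesis using that g by blast
qed

text \<open>Composition with the projections is a contraction on the dual and eventually fixes each
  element of a \<open>dual_comp V n\<close>.\<close>

lemma shrinking_tail:
  fixes f :: "'v \<Rightarrow>\<^sub>L real"
  assumes "shrinking_FDD V"
  shows "(\<lambda>N. f o\<^sub>L proj_blinfun N) \<longlonglongrightarrow> f"
proof -
  define T :: "nat \<Rightarrow> ('v \<Rightarrow>\<^sub>L real) \<Rightarrow> ('v \<Rightarrow>\<^sub>L real)" where "T = (\<lambda>N f. f o\<^sub>L proj_blinfun N)"
  have "(\<lambda>N. T N f) \<longlonglongrightarrow> id f"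
  proof (rule tendsto_on_dense_span[where T = T and L = id and D = "\<Union>n. dual_comp V n"])
    show "linear (T N)" for N
      by (intro linearI blinfun_eqI) (simp_all add: T_def plus_blinfun.rep_eq scaleR_blinfun.rep_eq)
    show "norm (T N f) \<le> norm f" for N f
      using norm_blinfun_compose[of f "proj_blinfun N"] mult_left_mono[OF norm_proj_blinfun[of N], of "norm f"]
      by (simp add: T_def)
    show "closure (span (\<Union>n. dual_comp V n)) = UNIV" using assms by (simp add: shrinking_FDD_def)
    show "(\<lambda>N. T N d) \<longlonglongrightarrow> id d" if d: "d \<in> (\<Union>n. dual_comp V n)" for d
    proof -
      obtain n where n: "d \<in> dual_comp V n" using d by blast
      have "T N d = d" if "N > n" for N
        using dual_comp_proj[OF n, of "{..<N}"] that
        by (intro blinfun_eqI) (simp add: T_def proj_blinfun_apply)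
      then show ?thesis
        by (intro tendsto_eventually eventually_sequentiallyI[of "Suc n"]) auto
    qed
  qed (simp_all add: linear_id)
  then show ?thesis by (simp add: T_def)
qed

text \<open>A functional on the dual that kills every \<open>dual_comp V n\<close> is evaluation at
  some \<open>v\<close>; all coordinates of \<open>v\<close> then vanish, so
  \<open>v = 0\<close>.\<close>

lemma reflexive_imp_shrinking:
  assumes "reflexive TYPE('v)"
  shows "shrinking_FDD V"
proof (rule ccontr)
  let ?S = "closure (span (\<Union>n. dual_comp V n))"
  assume "\<not> shrinking_FDD V"
  then obtain f where "f \<notin> ?S" by (auto simp: shrinking_FDD_def)
  moreover have "subspace ?S" by (intro subspace_closure subspace_span)
  moreover have "closed ?S" by simp
  ultimately obtain \<phi> :: "('v \<Rightarrow>\<^sub>L real) \<Rightarrow>\<^sub>L real"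
    where \<phi>: "blinfun_apply \<phi> f \<noteq> 0" "\<And>s. s \<in> ?S \<Longrightarrow> blinfun_apply \<phi> s = 0"
    using hahn_banach_separation[of ?S f] by blast
  obtain v where v: "\<And>f. blinfun_apply \<phi> f = blinfun_apply f v"
    using assms unfolding reflexive_def by blast
  have "coord V n v = 0" for n
  proof -
    obtain h :: "'v \<Rightarrow>\<^sub>L real" where h: "blinfun_apply h (coord V n v) = norm (coord V n v)"
      using norming_functional by blast
    obtain g where g: "g \<in> dual_comp V n" "\<And>v. blinfun_apply g v = blinfun_apply h (coord V n v)"
      using coord_compose_dual_comp by blast
    then have "g \<in> span (\<Union>n. dual_comp V n)" by (intro span_base) blast
    then have "g \<in> ?S" using closure_subset by (rule subsetD[rotated])
    then have "blinfun_apply g v = 0" using \<phi>(2) v by metis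
    then show ?thesis using g h by simp
  qed
  then have "(\<lambda>_. 0) sums v" using coord_sums[of v] by simp
  then have "v = 0" by (rule sums_unique2) (rule sums_zero)
  then show False using \<phi>(1) v by (simp add: blinfun.zero_right)
qed

end

locale fdd_net = bimonotone_fdd V for V :: "nat \<Rightarrow> 'v::banach set" +
  fixes l :: "nat \<Rightarrow> nat" and x :: "nat \<Rightarrow> nat \<Rightarrow> ('v \<Rightarrow>\<^sub>L real)"
  assumes l_pos: "1 \<le> l n"
    and x_dual: "1 \<le> i \<Longrightarrow> i \<le> l n \<Longrightarrow> x n i \<in> dual_comp V n"
    and x_norm: "1 \<le> i \<Longrightarrow> i \<le> l n \<Longrightarrow> norm (x n i) \<le> 1"
    and x_nonzero: "1 \<le> i \<Longrightarrow> i \<le> l n \<Longrightarrow> x n i \<noteq> 0"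
begin

abbreviation sel :: "(nat \<Rightarrow> nat) \<Rightarrow> bool" where
  "sel ii \<equiv> \<forall>n. 1 \<le> ii n \<and> ii n \<le> l n"

lemma x_proj:
  "sel ii \<Longrightarrow> finite A \<Longrightarrow> blinfun_apply (x n (ii n)) (proj A v) = (if n \<in> A then blinfun_apply (x n (ii n)) v else 0)"
  by (rule dual_comp_proj) (simp_all add: x_dual)

lemma partial_sum_proj:
  assumes "sel ii" "finite A" "A \<subseteq> {..<N}"
  shows "(\<Sum>n\<in>A. a n * blinfun_apply (x n (ii n)) v) = (\<Sum>n<N. a n * blinfun_apply (x n (ii n)) (proj A v))"
  using assms by (intro sum.mono_neutral_cong_left) (auto simp: x_proj)

lemma adm_sel: "adm l x a ii \<Longrightarrow> sel ii"
  by (simp add: adm_def)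

lemma partial_sums_block:
  assumes "sel ii" and le: "\<And>N v. \<bar>\<Sum>n<N. a n * blinfun_apply (x n (ii n)) v\<bar> \<le> norm v"
  shows "\<bar>\<Sum>n\<in>{p..<q}. a n * blinfun_apply (x n (ii n)) v\<bar> \<le> norm (proj {p..<q} v)"
proof -
  have "(\<Sum>n\<in>{p..<q}. a n * blinfun_apply (x n (ii n)) v)
      = (\<Sum>n<q. a n * blinfun_apply (x n (ii n)) (proj {p..<q} v))"
    using assms(1) by (intro partial_sum_proj) auto
  then show ?thesis by (simp add: le)
qed

text \<open>The \<open>x n (ii n)\<close> vanish off their own component. So a partial sum is the
  full sum at a projected vector, and conversely uniform bounds on partial sums bound each block by
  the norm of the same block of \<open>v\<close>, which gives convergence. In this finite form
  admissibility is easily seen to survive truncation, sign changes and limits.\<close>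

lemma adm_iff:
  "adm l x a ii \<longleftrightarrow> sel ii \<and> (\<forall>N v. \<bar>\<Sum>n<N. a n * blinfun_apply (x n (ii n)) v\<bar> \<le> norm v)"
proof (intro iffI conjI allI)
  fix N v
  assume a: "adm l x a ii"
  then have sel: "sel ii" by (rule adm_sel)
  have "(\<Sum>n. a n * blinfun_apply (x n (ii n)) (proj {..<N} v))
      = (\<Sum>n<N. a n * blinfun_apply (x n (ii n)) (proj {..<N} v))"
    using sel by (intro suminf_finite) (auto simp: x_proj)
  also have "\<dots> = (\<Sum>n<N. a n * blinfun_apply (x n (ii n)) v)"
    using partial_sum_proj[OF sel, of "{..<N}" N] by simp
  finally have "(\<Sum>n<N. a n * blinfun_apply (x n (ii n)) v)
      = (\<Sum>n. a n * blinfun_apply (x n (ii n)) (proj {..<N} v))" by (rule sym)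
  moreover have "\<bar>\<Sum>n. a n * blinfun_apply (x n (ii n)) u\<bar> \<le> norm u" for u
    using a unfolding adm_def by blast
  ultimately have "\<bar>\<Sum>n<N. a n * blinfun_apply (x n (ii n)) v\<bar> \<le> norm (proj {..<N} v)"
    by (simp only:)
  then show "\<bar>\<Sum>n<N. a n * blinfun_apply (x n (ii n)) v\<bar> \<le> norm v"
    using norm_proj_lessThan_le[of v N] by linarith
next
  assume a: "sel ii \<and> (\<forall>N v. \<bar>\<Sum>n<N. a n * blinfun_apply (x n (ii n)) v\<bar> \<le> norm v)"
  then have block: "\<bar>\<Sum>n\<in>{p..<q}. a n * blinfun_apply (x n (ii n)) v\<bar> \<le> norm (proj {p..<q} v)" for p q v
    using partial_sums_block by blast
  have summable: "summable (\<lambda>n. a n * blinfun_apply (x n (ii n)) v)" for v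
    unfolding summable_Cauchy
  proof (intro allI impI)
    fix \<epsilon> :: real assume "\<epsilon> > 0"
    then obtain N where N: "\<And>p q. N \<le> p \<Longrightarrow> p \<le> q \<Longrightarrow> norm (proj {p..<q} v) < \<epsilon>"
      using proj_block_small by blast
    have "norm (\<Sum>n\<in>{p..<q}. a n * blinfun_apply (x n (ii n)) v) < \<epsilon>" if "p \<ge> N" for p q
    proof (cases "p \<le> q")
      case True
      then show ?thesis using N[OF that] block[where p = p and q = q and v = v] by (simp add: order_le_less_trans)
    qed (use \<open>\<epsilon> > 0\<close> in simp)
    then show "\<exists>N. \<forall>p\<ge>N. \<forall>q. norm (\<Sum>n\<in>{p..<q}. a n * blinfun_apply (x n (ii n)) v) < \<epsilon>" by blast
  qed
  have "\<bar>\<Sum>n. a n * blinfun_apply (x n (ii n)) v\<bar> \<le> norm v" for v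
    by (rule LIMSEQ_le_const2[OF tendsto_rabs[OF summable_LIMSEQ[OF summable]]]) (use a in blast)
  then show "adm l x a ii"
    unfolding adm_def using a summable by blast
next
  show "1 \<le> ii n" "ii n \<le> l n" if "adm l x a ii" for n
    using adm_sel[OF that] by simp_all
qed

lemma adm_partial: "adm l x a ii \<Longrightarrow> \<bar>\<Sum>n<N. a n * blinfun_apply (x n (ii n)) v\<bar> \<le> norm v"
  by (simp add: adm_iff)

lemma adm_block: "adm l x a ii \<Longrightarrow>
    \<bar>\<Sum>n\<in>{p..<q}. a n * blinfun_apply (x n (ii n)) v\<bar> \<le> norm (proj {p..<q} v)"
  by (simp add: adm_iff partial_sums_block)

lemma adm_sums: "adm l x a ii \<Longrightarrow>
    (\<lambda>N. \<Sum>n<N. a n * blinfun_apply (x n (ii n)) v) \<longlonglongrightarrow> (\<Sum>n. a n * blinfun_apply (x n (ii n)) v)"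
  by (simp add: adm_def summable_LIMSEQ)

lemma adm_uminus: "adm l x a ii \<Longrightarrow> adm l x (\<lambda>n. - a n) ii"
  by (simp add: adm_iff sum_negf)

lemma adm_zero: "sel ii \<Longrightarrow> adm l x (\<lambda>n. 0) ii"
  by (simp add: adm_iff)

lemma sel_one: "sel (\<lambda>n. 1)"
  using l_pos by simp

lemma sum_truncate:
  fixes f :: "nat \<Rightarrow> real"
  shows "(\<Sum>n<N. (if n < q then a n else 0) * f n) = (\<Sum>n<min N q. a n * f n)"
  by (rule sum.mono_neutral_cong_right) auto

lemma adm_truncate: "adm l x a ii \<Longrightarrow> adm l x (\<lambda>n. if n < q then a n else 0) ii"
  by (simp add: adm_iff sum_truncate)

lemma adm_unit:
  assumes "sel ii"
  shows "adm l x (\<lambda>m. if m = n then 1 else 0) ii"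
  unfolding adm_iff
proof (intro conjI allI)
  fix N v
  have "norm (blinfun_apply (x n (ii n)) v) \<le> norm v"
    using norm_blinfun[of "x n (ii n)" v] x_norm[of "ii n" n] assms mult_right_mono[of "norm (x n (ii n))" 1 "norm v"]
    by simp
  then show "\<bar>\<Sum>m<N. (if m = n then 1 else 0) * blinfun_apply (x m (ii m)) v\<bar> \<le> norm v"
    by (simp add: if_distrib[of "\<lambda>c. c * _"] cong: if_cong)
qed (use assms in auto)

text \<open>The single level \<open>n\<close> is a block, so \<open>a n *\<^sub>R x n (ii n)\<close>
  has norm at most 1. The resulting bound makes the supremum in \<open>wnorm\<close> finite and the
  admissible pairs compact.\<close>

lemma adm_coeff_le:
  assumes "adm l x a ii"
  shows "\<bar>a n\<bar> \<le> 1 / norm (x n (ii n))"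
proof -
  have "norm (a n *\<^sub>R x n (ii n)) \<le> 1"
  proof (rule norm_blinfun_bound)
    show "norm (blinfun_apply (a n *\<^sub>R x n (ii n)) v) \<le> 1 * norm v" for v
      using adm_block[OF assms, where p = n and q = "Suc n" and v = v] norm_proj_le[of v n "Suc n"]
      by (simp add: scaleR_blinfun.rep_eq)
  qed simp
  moreover have "norm (x n (ii n)) > 0" using x_nonzero adm_sel[OF assms] by simp
  ultimately show ?thesis by (simp add: field_simps)
qed

text \<open>Each condition in \<open>adm_iff\<close> involves finitely many levels, so convergence
  level by level suffices.\<close>

lemma adm_limit:
  assumes adm: "\<And>m. adm l x (a' m) (ii' m)"
    and a: "\<And>n. (\<lambda>m. a' m n) \<longlonglongrightarrow> a n"
    and ii: "\<And>n. \<forall>\<^sub>F m in sequentially. ii' m n = ii n"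
  shows "adm l x a ii"
  unfolding adm_iff
proof (intro conjI allI)
  fix n
  obtain m where m: "ii' m n = ii n" using eventually_happens[OF ii[of n]] by auto
  show "1 \<le> ii n" "ii n \<le> l n" using adm_sel[OF adm[of m], rule_format, of n] by (simp_all add: m)
next
  fix N v
  have "(\<lambda>m. blinfun_apply (x n (ii' m n)) v) \<longlonglongrightarrow> blinfun_apply (x n (ii n)) v" for n
    using ii[of n] by (intro tendsto_eventually) (auto elim: eventually_mono)
  then have "(\<lambda>m. \<bar>\<Sum>n<N. a' m n * blinfun_apply (x n (ii' m n)) v\<bar>)
      \<longlonglongrightarrow> \<bar>\<Sum>n<N. a n * blinfun_apply (x n (ii n)) v\<bar>"
    by (intro tendsto_rabs tendsto_sum tendsto_mult a)
  then show "\<bar>\<Sum>n<N. a n * blinfun_apply (x n (ii n)) v\<bar> \<le> norm v"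
    by (rule LIMSEQ_le_const2) (use adm_partial[OF adm] in blast)
qed

text \<open>Provides a bounded functional on V to which the shrinking property can be
  applied.\<close>

lemma adm_functional:
  assumes adm: "adm l x a ii"
  obtains \<phi> :: "'v \<Rightarrow>\<^sub>L real"
  where "\<And>p q v. blinfun_apply \<phi> (proj {p..<q} v) = (\<Sum>n\<in>{p..<q}. a n * blinfun_apply (x n (ii n)) v)"
proof -
  define f where "f = (\<lambda>v. \<Sum>n. a n * blinfun_apply (x n (ii n)) v)"
  have s: "summable (\<lambda>n. a n * blinfun_apply (x n (ii n)) v)" for v using adm by (simp add: adm_def)
  have bl: "bounded_linear f"
  proof (rule bounded_linear_intro[where K = 1])
    show "f (u + v) = f u + f v" for u v
      by (simp add: f_def blinfun.add_right distrib_left suminf_add[OF s s])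
    show "f (t *\<^sub>R v) = t *\<^sub>R f v" for t v
      using suminf_mult[OF s[of v], of t] by (simp add: f_def blinfun.scaleR_right ac_simps)
    show "norm (f v) \<le> norm v * 1" for v using adm by (simp add: f_def adm_def)
  qed
  show ?thesis
  proof (rule that[of "Blinfun f"])
    fix p q v
    have "f (proj {p..<q} v) = (\<Sum>n<q. a n * blinfun_apply (x n (ii n)) (proj {p..<q} v))"
      unfolding f_def using adm_sel[OF adm] by (intro suminf_finite) (auto simp: x_proj)
    also have "\<dots> = (\<Sum>n\<in>{p..<q}. a n * blinfun_apply (x n (ii n)) v)"
      by (rule partial_sum_proj[OF adm_sel[OF adm], symmetric]) auto
    finally show "blinfun_apply (Blinfun f) (proj {p..<q} v) = (\<Sum>n\<in>{p..<q}. a n * blinfun_apply (x n (ii n)) v)"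
      by (simp add: bounded_linear_Blinfun_apply[OF bl])
  qed
qed

text \<open>The signs move from the coefficients to the vector: flipping the first \<open>N\<close>
  coordinates of \<open>v\<close> gives \<open>w\<close>, whose norm is that of the unflipped
  partial sum.\<close>

lemma adm_signs:
  assumes "unconditional_FDD V" and adm: "adm l x a ii" and \<sigma>: "\<And>n. \<sigma> n = 1 \<or> \<sigma> n = (-1::real)"
  shows "adm l x (\<lambda>n. \<sigma> n * a n) ii"
  unfolding adm_iff
proof (intro conjI allI)
  fix N v
  have sel: "sel ii" using adm by (rule adm_sel)
  define w where "w = (\<Sum>n<N. \<sigma> n *\<^sub>R coord V n v)"
  have "norm w = norm (proj {..<N} v)"
    using assms(1)[unfolded unconditional_FDD_def, rule_format, of "\<lambda>n. coord V n v" \<sigma> N] coord_mem \<sigma>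
    by (simp add: w_def)
  then have w: "norm w \<le> norm v" using norm_proj_lessThan_le[of v N] by simp
  have "coord V n w = \<sigma> n *\<^sub>R coord V n v" if "n < N" for n
  proof -
    have "coord V n w = (\<Sum>j<N. \<sigma> j *\<^sub>R coord V n (coord V j v))"
      by (simp add: w_def linear_sum linear_scale linear_coord)
    also have "\<dots> = (\<Sum>j<N. if j = n then \<sigma> n *\<^sub>R coord V n v else 0)"
    proof (rule sum.cong)
      show "\<sigma> j *\<^sub>R coord V n (coord V j v) = (if j = n then \<sigma> n *\<^sub>R coord V n v else 0)" for j
        using coord_proj[where A = "{j}" and m = n and v = v] by auto
    qed simp
    finally show ?thesis using that by simp
  qed
  then have "blinfun_apply (x n (ii n)) w = \<sigma> n * blinfun_apply (x n (ii n)) v" if "n < N" for n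
    using that x_dual[of "ii n" n] sel dual_comp_apply[of "x n (ii n)" n]
    by (metis blinfun.scaleR_right real_scaleR_def)
  then have "(\<Sum>n<N. (\<sigma> n * a n) * blinfun_apply (x n (ii n)) v) = (\<Sum>n<N. a n * blinfun_apply (x n (ii n)) w)"
    by (intro sum.cong) auto
  then show "\<bar>\<Sum>n<N. (\<sigma> n * a n) * blinfun_apply (x n (ii n)) v\<bar> \<le> norm v"
    using adm_partial[OF adm, where N = N and v = w] w by simp
qed (use adm_sel[OF adm] in auto)

section \<open>Equivalence of \<open>tnorm\<close> with the original norm\<close>

lemma tnorm_upper:
  assumes "adm l x a ii"
  shows "\<bar>\<Sum>n. a n * blinfun_apply (x n (ii n)) v\<bar> \<le> tnorm l x v"
  unfolding tnorm_def using assms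
  by (intro cSup_upper bdd_aboveI[where M = "norm v"]) (auto simp: adm_def)

lemma tnorm_least:
  assumes "\<And>a ii. adm l x a ii \<Longrightarrow> \<bar>\<Sum>n. a n * blinfun_apply (x n (ii n)) v\<bar> \<le> t"
  shows "tnorm l x v \<le> t"
  unfolding tnorm_def using assms adm_zero[OF sel_one]
  by (intro cSup_least) blast+

lemma tnorm_le_norm: "tnorm l x v \<le> norm v"
  by (rule tnorm_least) (simp add: adm_def)

text \<open>A net approximation of a norming functional has norm at most \<open>4/3\<close>, and \<open>3/4\<close> of it is
  admissible with value at least \<open>3/4 (1 - 1/3) = 1/2\<close> of the norm.\<close>
lemma tnorm_lower:
  fixes \<epsilon> :: "nat \<Rightarrow> real"
  assumes eps: "\<And>n. 0 \<le> \<epsilon> n" "summable \<epsilon>" "(\<Sum>n. \<epsilon> n) < 1/3"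
    and net: "\<And>n f. f \<in> dual_comp V n \<Longrightarrow> norm f \<le> 1 \<Longrightarrow> \<exists>i. 1 \<le> i \<and> i \<le> l n \<and> norm (f - x n i) \<le> \<epsilon> n"
  shows "norm v / 2 \<le> tnorm l x v"
proof -
  obtain \<phi> :: "'v \<Rightarrow>\<^sub>L real" where \<phi>: "norm \<phi> \<le> 1" "blinfun_apply \<phi> v = norm v"
    using norming_functional by blast
  have "\<exists>f. f \<in> dual_comp V n \<and> norm f \<le> 1 \<and> (\<forall>v. blinfun_apply f v = blinfun_apply \<phi> (coord V n v))" for n
    using coord_compose_dual_comp[of n \<phi>] \<phi>(1) by (metis order_trans)
  then obtain f where f: "\<And>n. f n \<in> dual_comp V n" "\<And>n. norm (f n) \<le> 1"
    "\<And>n v. blinfun_apply (f n) v = blinfun_apply \<phi> (coord V n v)" by metis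
  obtain ii where ii: "\<And>n. 1 \<le> ii n \<and> ii n \<le> l n" "\<And>n. norm (f n - x n (ii n)) \<le> \<epsilon> n"
    using net[OF f(1,2)] by metis
  have eps_le: "(\<Sum>n<N. \<epsilon> n) \<le> 1/3" for N
    using sum_le_suminf[OF eps(2), of "{..<N}"] eps by force
  have close: "\<bar>(\<Sum>n<N. blinfun_apply (x n (ii n)) u) - blinfun_apply \<phi> (proj {..<N} u)\<bar> \<le> norm u / 3" for N u
  proof -
    have "(\<Sum>n<N. blinfun_apply (x n (ii n)) u) - blinfun_apply \<phi> (proj {..<N} u)
        = - (\<Sum>n<N. blinfun_apply (f n - x n (ii n)) u)"
      by (simp add: blinfun.sum_right f(3) minus_blinfun.rep_eq sum_subtractf)
    also have "\<bar>\<dots>\<bar> \<le> (\<Sum>n<N. \<bar>blinfun_apply (f n - x n (ii n)) u\<bar>)"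
      by simp
    also have "\<dots> \<le> (\<Sum>n<N. \<epsilon> n * norm u)"
    proof (rule sum_mono)
      show "\<bar>blinfun_apply (f n - x n (ii n)) u\<bar> \<le> \<epsilon> n * norm u" for n
        using norm_blinfun[of "f n - x n (ii n)" u] mult_right_mono[OF ii(2)[of n] norm_ge_zero[of u]] by simp
    qed
    also have "\<dots> = (\<Sum>n<N. \<epsilon> n) * norm u" by (simp add: sum_distrib_right)
    also have "\<dots> \<le> 1/3 * norm u" using eps_le by (intro mult_right_mono) auto
    finally show ?thesis by simp
  qed
  have adm: "adm l x (\<lambda>_. 3/4) ii"
    unfolding adm_iff
  proof (intro conjI allI)
    fix N u
    have "\<bar>blinfun_apply \<phi> (proj {..<N} u)\<bar> \<le> norm u"
      using norm_blinfun[of \<phi> "proj {..<N} u"] mult_right_mono[OF \<phi>(1), of "norm (proj {..<N} u)"]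
        norm_proj_lessThan_le[of u N] by simp
    then have "\<bar>\<Sum>n<N. blinfun_apply (x n (ii n)) u\<bar> \<le> 4/3 * norm u"
      using close[where N = N and u = u] by linarith
    then show "\<bar>\<Sum>n<N. 3/4 * blinfun_apply (x n (ii n)) u\<bar> \<le> norm u"
      unfolding sum_distrib_left[symmetric] by (simp add: abs_mult)
  qed (use ii in auto)
  have "3/4 * (blinfun_apply \<phi> (proj {..<N} v) - norm v / 3) \<le> (\<Sum>n<N. 3/4 * blinfun_apply (x n (ii n)) v)" for N
    unfolding sum_distrib_left[symmetric] using abs_le_D2[OF close[where N = N and u = v]]
    by (intro mult_left_mono) (simp_all add: algebra_simps)
  moreover have "(\<lambda>N. 3/4 * (blinfun_apply \<phi> (proj {..<N} v) - norm v / 3)) \<longlonglongrightarrow> 3/4 * (blinfun_apply \<phi> v - norm v / 3)"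
    by (intro tendsto_intros proj_tendsto)
  ultimately have "3/4 * (blinfun_apply \<phi> v - norm v / 3) \<le> (\<Sum>n. 3/4 * blinfun_apply (x n (ii n)) v)"
    by (intro LIMSEQ_le[OF _ adm_sums[OF adm]]) auto
  then show ?thesis using tnorm_upper[OF adm, of v] \<phi>(2) by simp
qed

end

section \<open>Initial segments and the space W\<close>

lemma finite_lex_predecessors: "finite {d \<in> Gam l. lex_less d g}"
proof (rule finite_subset)
  show "{d \<in> Gam l. lex_less d g} \<subseteq> (SIGMA n:{..fst g}. {..l n})"
    by (auto simp: Gam_def lex_less_def)
qed auto

lemma lex_less_trans: "lex_less a b \<Longrightarrow> lex_less b c \<Longrightarrow> lex_less a c"
  by (auto simp: lex_less_def)

lemma lex_less_linear: "a = b \<or> lex_less a b \<or> lex_less b a"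
  by (auto simp: lex_less_def prod_eq_iff)

lemma lexrank_strict_mono:
  assumes "d \<in> Gam l" "lex_less d g"
  shows "lexrank (Gam l) d < lexrank (Gam l) g"
  unfolding lexrank_def
proof (rule psubset_card_mono[OF finite_lex_predecessors])
  have "d \<in> {d \<in> Gam l. lex_less d g}" "d \<notin> {d' \<in> Gam l. lex_less d' d}"
    using assms by (auto simp: lex_less_def)
  moreover have "{d' \<in> Gam l. lex_less d' d} \<subseteq> {d \<in> Gam l. lex_less d g}"
    using assms lex_less_trans by blast
  ultimately show "{d' \<in> Gam l. lex_less d' d} \<subset> {d \<in> Gam l. lex_less d g}" by blast
qed

lemma inj_on_lexrank: "inj_on (lexrank (Gam l)) (Gam l)"
proof (rule inj_onI)
  fix g h assume gh: "g \<in> Gam l" "h \<in> Gam l" "lexrank (Gam l) g = lexrank (Gam l) h"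
  show "g = h"
    using lex_less_linear[of g h] lexrank_strict_mono[OF gh(1), of h] lexrank_strict_mono[OF gh(2), of g] gh(3)
    by auto
qed

definition init_seg :: "(nat \<Rightarrow> nat) \<Rightarrow> nat \<Rightarrow> (nat \<times> nat) set" where
  "init_seg l k = {g \<in> Gam l. lexrank (Gam l) g < k}"

lemma psum_init_seg: "psum (Gam l) c e k = (\<Sum>g\<in>init_seg l k. c g *\<^sub>R e g)"
  by (simp add: psum_def init_seg_def)

lemma init_seg_subset: "init_seg l k \<subseteq> Gam l"
  by (auto simp: init_seg_def)

lemma finite_init_seg: "finite (init_seg l k)"
proof (rule finite_imageD)
  show "finite (lexrank (Gam l) ` init_seg l k)"
    by (rule finite_subset[of _ "{..<k}"]) (auto simp: init_seg_def)
  show "inj_on (lexrank (Gam l)) (init_seg l k)"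
    using inj_on_lexrank init_seg_subset by (rule inj_on_subset)
qed

lemma init_seg_mono: "j \<le> k \<Longrightarrow> init_seg l j \<subseteq> init_seg l k"
  by (auto simp: init_seg_def)

lemma init_seg_lex_closed: "g \<in> init_seg l k \<Longrightarrow> d \<in> Gam l \<Longrightarrow> lex_less d g \<Longrightarrow> d \<in> init_seg l k"
  using lexrank_strict_mono[of d l g] by (auto simp: init_seg_def)

lemma eventually_init_seg:
  assumes "g \<in> Gam l"
  shows "\<forall>\<^sub>F k in sequentially. g \<in> init_seg l k"
  using assms by (intro eventually_sequentiallyI[of "Suc (lexrank (Gam l) g)"]) (auto simp: init_seg_def)

lemma eventually_init_seg_finite:
  assumes "finite F" "F \<subseteq> Gam l"
  shows "\<forall>\<^sub>F k in sequentially. F \<subseteq> init_seg l k"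
  using eventually_ball_finite[OF assms(1), of "\<lambda>k g. g \<in> init_seg l k"] eventually_init_seg assms(2)
  by (simp add: subset_eq)

lemma eventually_init_seg_levels:
  "\<forall>\<^sub>F k in sequentially. {g \<in> Gam l. fst g < N} \<subseteq> init_seg l k"
proof (rule eventually_init_seg_finite)
  show "finite {g \<in> Gam l. fst g < N}"
    by (rule finite_subset[of _ "SIGMA n:{..<N}. {..l n}"]) (auto simp: Gam_def)
qed auto

text \<open>With an element, an initial segment contains all lower levels completely, so its trace
  on a selection is downward closed, and it is finite. On the level where the segment ends,
  membership depends on the chosen index; hence \<open>N\<close> depends on
  \<open>ii\<close>.\<close>

lemma init_seg_section:
  assumes "\<And>n. (n, ii n) \<in> Gam l"
  obtains N where "\<And>n. (n, ii n) \<in> init_seg l k \<longleftrightarrow> n < N"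
proof -
  define D where "D = {n. (n, ii n) \<in> init_seg l k}"
  have "(\<lambda>n. (n, ii n)) ` D \<subseteq> init_seg l k" by (auto simp: D_def)
  then have "finite D"
    using finite_subset[OF _ finite_init_seg] by (auto intro!: finite_imageD[of "\<lambda>n. (n, ii n)" D] inj_onI)
  then have ex: "\<exists>n. n \<notin> D" using ex_new_if_finite[OF infinite_UNIV_nat] by blast
  have down: "m \<in> D" if "n \<in> D" "m < n" for m n
    using init_seg_lex_closed[of "(n, ii n)" l k "(m, ii m)"] assms[of m] that by (auto simp: D_def lex_less_def)
  define N where "N = (LEAST n. n \<notin> D)"
  have "N \<notin> D" unfolding N_def using ex by (rule LeastI_ex)
  moreover have "n \<in> D" if "n < N" for n using not_less_Least that unfolding N_def by blast
  ultimately have "n \<in> D \<longleftrightarrow> n < N" for n using down by (metis not_less_iff_gr_or_eq)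
  then show ?thesis using that by (auto simp: D_def)
qed

text \<open>The \<open>g\<close>-th coordinate of the functional \<open>\<Sum>\<^sub>n a\<^sub>n e\<^sup>*(n, i\<^sub>n)\<close>.\<close>
definition selcoef :: "(nat \<Rightarrow> real) \<Rightarrow> (nat \<Rightarrow> nat) \<Rightarrow> nat \<times> nat \<Rightarrow> real" where
  "selcoef a ii g = (if snd g = ii (fst g) then a (fst g) else 0)"

lemma sum_selcoef_finite:
  assumes "finite F"
  shows "(\<Sum>g\<in>F. c g * selcoef a ii g) = (\<Sum>n\<in>{n. (n, ii n) \<in> F}. a n * c (n, ii n))"
proof -
  have "(\<Sum>g\<in>F. c g * selcoef a ii g) = (\<Sum>g\<in>{g\<in>F. snd g = ii (fst g)}. a (fst g) * c g)"
    using assms by (intro sum.mono_neutral_cong_right) (auto simp: selcoef_def)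
  also have "\<dots> = (\<Sum>n\<in>{n. (n, ii n) \<in> F}. a n * c (n, ii n))"
    by (rule sum.reindex_bij_witness[where i = "\<lambda>n. (n, ii n)" and j = fst]) auto
  finally show ?thesis .
qed

lemma suminf_selcoef:
  assumes "finite F"
  shows "(\<Sum>n. a n * (if (n, ii n) \<in> F then c (n, ii n) else 0)) = (\<Sum>g\<in>F. c g * selcoef a ii g)"
proof -
  have fin: "finite {n. (n, ii n) \<in> F}"
    using assms by (rule finite_subset[rotated, OF finite_imageI[of F fst]]) force
  have "(\<Sum>n. a n * (if (n, ii n) \<in> F then c (n, ii n) else 0))
      = (\<Sum>n\<in>{n. (n, ii n) \<in> F}. a n * (if (n, ii n) \<in> F then c (n, ii n) else 0))"
    by (rule suminf_finite[OF fin]) auto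
  also have "\<dots> = (\<Sum>g\<in>F. c g * selcoef a ii g)"
    by (simp add: sum_selcoef_finite[OF assms])
  finally show ?thesis .
qed

lemma LIMSEQ_real_of_nat_eventually_const:
  fixes i :: "nat \<Rightarrow> nat"
  assumes "(\<lambda>m. real (i m)) \<longlonglongrightarrow> L"
  obtains j where "\<forall>\<^sub>F m in sequentially. i m = j"
proof -
  obtain M where "\<And>m n. m \<ge> M \<Longrightarrow> n \<ge> M \<Longrightarrow> norm (real (i m) - real (i n)) < 1"
    using CauchyD[OF LIMSEQ_imp_Cauchy[OF assms], of 1] by auto
  then have "i m = i M" if "m \<ge> M" for m using that by (force simp: abs_if split: if_splits)
  then show ?thesis using that by (auto simp: eventually_sequentially)
qed

text \<open>W is described up to isometry: a Banach space in which the finite combinations of the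
  \<open>e g\<close> have the prescribed norm and are dense is the completion of c00.\<close>

locale fdd_net_space = fdd_net V l x for V :: "nat \<Rightarrow> 'v::banach set" and l and x +
  fixes e :: "nat \<times> nat \<Rightarrow> 'w::banach"
  assumes W_norm: "finite F \<Longrightarrow> F \<subseteq> Gam l \<Longrightarrow>
      norm (\<Sum>g\<in>F. c g *\<^sub>R e g) = wnorm l x (\<lambda>g. if g \<in> F then c g else 0)"
    and W_dense: "closure (span (e ` Gam l)) = UNIV"
begin

section \<open>Functionals of admissible pairs and basis projections\<close>

lemma sel_Gam: "sel ii \<Longrightarrow> (n, ii n) \<in> Gam l"
  by (simp add: Gam_def)

lemma adm_sum_le_norm:
  assumes "finite F" "F \<subseteq> Gam l" "adm l x a ii"
  shows "(\<Sum>g\<in>F. c g * selcoef a ii g) \<le> norm (\<Sum>g\<in>F. c g *\<^sub>R e g)"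
proof -
  \<comment> \<open>A bound independent of the pair, so that \<open>Sup\<close> really is a least
    upper bound.\<close>
  have "(\<Sum>g\<in>F. c g * selcoef a ii g) \<le> (\<Sum>g\<in>F. \<bar>c g\<bar> * (1 / norm (x (fst g) (snd g))))"
    if "adm l x a ii" for a ii
  proof (rule sum_mono)
    fix g
    have "\<bar>selcoef a ii g\<bar> \<le> 1 / norm (x (fst g) (snd g))"
      using adm_coeff_le[OF that, of "fst g"] by (auto simp: selcoef_def)
    then have "\<bar>c g\<bar> * \<bar>selcoef a ii g\<bar> \<le> \<bar>c g\<bar> * (1 / norm (x (fst g) (snd g)))"
      by (intro mult_left_mono) auto
    then show "c g * selcoef a ii g \<le> \<bar>c g\<bar> * (1 / norm (x (fst g) (snd g)))"
      by (metis abs_ge_self abs_mult order_trans)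
  qed
  then have "bdd_above {\<Sum>g\<in>F. c g * selcoef a ii g | a ii. adm l x a ii}"
    by (intro bdd_aboveI[where M = "\<Sum>g\<in>F. \<bar>c g\<bar> * (1 / norm (x (fst g) (snd g)))"]) blast
  then have "(\<Sum>g\<in>F. c g * selcoef a ii g) \<le> Sup {\<Sum>g\<in>F. c g * selcoef a ii g | a ii. adm l x a ii}"
    using assms(3) by (intro cSup_upper) blast+
  then show ?thesis
    by (simp add: W_norm[OF assms(1,2)] wnorm_def suminf_selcoef[OF assms(1)])
qed

lemma norm_le_adm_sum:
  assumes "finite F" "F \<subseteq> Gam l"
    and le: "\<And>a ii. adm l x a ii \<Longrightarrow> (\<Sum>g\<in>F. c g * selcoef a ii g) \<le> t"
  shows "norm (\<Sum>g\<in>F. c g *\<^sub>R e g) \<le> t"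
proof -
  have "Sup {\<Sum>g\<in>F. c g * selcoef a ii g | a ii. adm l x a ii} \<le> t"
    using le adm_zero[OF sel_one] by (intro cSup_least) blast+
  then show ?thesis
    by (simp add: W_norm[OF assms(1,2)] wnorm_def suminf_selcoef[OF assms(1)])
qed

text \<open>The continuous extension to W of a functional from the set B. It exists for admissible
  pairs by Helly's condition and is determined by its values on the \<open>e g\<close>, whose span
  is dense.\<close>

definition bfun :: "(nat \<Rightarrow> real) \<Rightarrow> (nat \<Rightarrow> nat) \<Rightarrow> ('w \<Rightarrow>\<^sub>L real)" where
  "bfun a ii = (SOME f. norm f \<le> 1 \<and> (\<forall>g\<in>Gam l. blinfun_apply f (e g) = selcoef a ii g))"

lemma bfun_props:
  assumes "adm l x a ii"
  shows "norm (bfun a ii) \<le> 1 \<and> (\<forall>g\<in>Gam l. blinfun_apply (bfun a ii) (e g) = selcoef a ii g)"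
proof -
  have "\<exists>f :: 'w \<Rightarrow>\<^sub>L real. norm f \<le> 1 \<and> (\<forall>g\<in>Gam l. blinfun_apply f (e g) = selcoef a ii g)"
  proof (rule hahn_banach_helly[where I = "Gam l" and c = "selcoef a ii" and M = 1 and y = e])
    show "(\<Sum>g\<in>F. c g * selcoef a ii g) \<le> 1 * norm (\<Sum>g\<in>F. c g *\<^sub>R e g)"
      if "finite F" "F \<subseteq> Gam l" for F c
      using adm_sum_le_norm[OF that assms] by simp
  qed auto
  then show ?thesis unfolding bfun_def by (rule someI_ex)
qed

lemma norm_bfun: "adm l x a ii \<Longrightarrow> norm (bfun a ii) \<le> 1"
  and bfun_e: "adm l x a ii \<Longrightarrow> g \<in> Gam l \<Longrightarrow> blinfun_apply (bfun a ii) (e g) = selcoef a ii g"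
  using bfun_props by blast+

lemma bfun_le_norm: "adm l x a ii \<Longrightarrow> \<bar>blinfun_apply (bfun a ii) w\<bar> \<le> norm w"
  using norm_blinfun[of "bfun a ii" w] mult_right_mono[OF norm_bfun[of a ii] norm_ge_zero[of w]] by simp

lemma blinfun_eqI_basis:
  fixes f h :: "'w \<Rightarrow>\<^sub>L real"
  shows "(\<And>g. g \<in> Gam l \<Longrightarrow> blinfun_apply f (e g) = blinfun_apply h (e g)) \<Longrightarrow> f = h"
  by (rule blinfun_eq_on_dense_span[OF W_dense]) auto

text \<open>The coordinate functional at \<open>g\<close> itself belongs to an admissible pair:
  weight 1 on the level of \<open>g\<close>, along a selection through \<open>g\<close> that takes
  the index 1 elsewhere.\<close>

definition dual_basis :: "nat \<times> nat \<Rightarrow> ('w \<Rightarrow>\<^sub>L real)" where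
  "dual_basis g = bfun (\<lambda>m. if m = fst g then 1 else 0) (\<lambda>m. if m = fst g then snd g else 1)"

lemma dual_basis_e:
  assumes g: "g \<in> Gam l" and d: "d \<in> Gam l"
  shows "blinfun_apply (dual_basis g) (e d) = (if d = g then 1 else 0)"
proof -
  have "sel (\<lambda>m. if m = fst g then snd g else 1)" using g l_pos by (auto simp: Gam_def)
  from bfun_e[OF adm_unit[OF this] d] show ?thesis
    by (auto simp: dual_basis_def selcoef_def prod_eq_iff)
qed

definition pproj :: "nat \<Rightarrow> 'w \<Rightarrow> 'w" where
  "pproj k w = (\<Sum>g\<in>init_seg l k. blinfun_apply (dual_basis g) w *\<^sub>R e g)"

lemma linear_pproj: "linear (pproj k)"
  by (rule linearI)
    (simp_all add: pproj_def blinfun.add_right blinfun.scaleR_right scaleR_add_left sum.distrib scaleR_sum_right)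

lemma pproj_e:
  assumes "g \<in> Gam l"
  shows "pproj k (e g) = (if g \<in> init_seg l k then e g else 0)"
proof -
  have "pproj k (e g) = (\<Sum>d\<in>init_seg l k. if d = g then e g else 0)"
    unfolding pproj_def using assms init_seg_subset
    by (intro sum.cong) (auto simp: dual_basis_e subset_eq)
  then show ?thesis by (simp add: finite_init_seg)
qed

lemma init_seg_truncates:
  assumes adm: "adm l x a ii"
  shows "\<exists>N. (\<forall>n. (n, ii n) \<in> init_seg l k \<longleftrightarrow> n < N) \<and>
    (\<forall>w. blinfun_apply (bfun a ii) (pproj k w) = blinfun_apply (bfun (\<lambda>n. if n < N then a n else 0) ii) w)"
proof -
  obtain N where N: "\<And>n. (n, ii n) \<in> init_seg l k \<longleftrightarrow> n < N"
    using init_seg_section[of ii l k] sel_Gam[OF adm_sel[OF adm]] by blast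
  have "blinfun_apply (bfun a ii) (pproj k w) = blinfun_apply (bfun (\<lambda>n. if n < N then a n else 0) ii) w"
    for w
  proof -
    \<comment> \<open>The composition with \<open>pproj k\<close>, as a finite combination of
      coordinate functionals; it agrees with the truncated functional on each \<open>e g\<close>,
      hence everywhere.\<close>
    let ?f = "\<Sum>g\<in>init_seg l k. selcoef a ii g *\<^sub>R dual_basis g"
    have "?f = bfun (\<lambda>n. if n < N then a n else 0) ii"
    proof (rule blinfun_eqI_basis)
      fix g assume g: "g \<in> Gam l"
      have "blinfun_apply ?f (e g) = (\<Sum>d\<in>init_seg l k. if d = g then selcoef a ii g else 0)"
        unfolding blinfun.sum_left using g init_seg_subset
        by (intro sum.cong) (auto simp: scaleR_blinfun.rep_eq dual_basis_e subset_eq)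
      also have "\<dots> = selcoef (\<lambda>n. if n < N then a n else 0) ii g"
        using N[of "fst g"] by (cases g) (auto simp: finite_init_seg selcoef_def)
      finally show "blinfun_apply ?f (e g) = blinfun_apply (bfun (\<lambda>n. if n < N then a n else 0) ii) (e g)"
        by (simp add: bfun_e[OF adm_truncate[OF adm] g])
    qed
    moreover have "blinfun_apply (bfun a ii) (pproj k w) = blinfun_apply ?f w"
      unfolding pproj_def blinfun.sum_right blinfun.sum_left using init_seg_subset
      by (intro sum.cong) (auto simp: blinfun.scaleR_right scaleR_blinfun.rep_eq bfun_e[OF adm] subset_eq)
    ultimately show ?thesis by simp
  qed
  with N show ?thesis by blast
qed

lemma bfun_pproj:
  assumes "adm l x a ii"
  shows "blinfun_apply (bfun a ii) (pproj k w)
    = (\<Sum>g\<in>init_seg l k. blinfun_apply (dual_basis g) w * selcoef a ii g)"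
  unfolding pproj_def blinfun.sum_right using init_seg_subset
  by (intro sum.cong) (auto simp: blinfun.scaleR_right bfun_e[OF assms] subset_eq)

lemma norm_pproj_le: "norm (pproj k w) \<le> norm w"
proof -
  have "(\<Sum>g\<in>init_seg l k. blinfun_apply (dual_basis g) w * selcoef a ii g) \<le> norm w"
    if adm: "adm l x a ii" for a ii
  proof -
    obtain N where "\<And>n. (n, ii n) \<in> init_seg l k \<longleftrightarrow> n < N"
      "\<And>w. blinfun_apply (bfun a ii) (pproj k w) = blinfun_apply (bfun (\<lambda>n. if n < N then a n else 0) ii) w"
      using init_seg_truncates[OF adm, of k] by blast
    then show ?thesis
      using bfun_le_norm[OF adm_truncate[OF adm, of N], of w] bfun_pproj[OF adm, of k w] by simp
  qed
  then show ?thesis unfolding pproj_def by (intro norm_le_adm_sum finite_init_seg init_seg_subset)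
qed

lemma pproj_tendsto: "(\<lambda>k. pproj k w) \<longlonglongrightarrow> w"
proof -
  have "(\<lambda>k. pproj k w) \<longlonglongrightarrow> id w"
  proof (rule tendsto_on_dense_span[where T = pproj and L = id and D = "e ` Gam l"])
    show "(\<lambda>k. pproj k d) \<longlonglongrightarrow> id d" if "d \<in> e ` Gam l" for d
    proof -
      obtain g where g: "g \<in> Gam l" "d = e g" using \<open>d \<in> e ` Gam l\<close> by blast
      show ?thesis
        by (rule tendsto_eventually, rule eventually_mono[OF eventually_init_seg[OF g(1)]])
          (simp add: pproj_e g)
    qed
  qed (simp_all add: linear_pproj linear_id norm_pproj_le W_dense)
  then show ?thesis by simp
qed

lemma lex_basis_e: "lex_basis (Gam l) e"
  unfolding lex_basis_def
proof (intro allI ex1I conjI impI)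
  fix w :: 'w
  let ?c = "\<lambda>g. if g \<in> Gam l then blinfun_apply (dual_basis g) w else 0"
  have "psum (Gam l) ?c e = (\<lambda>k. pproj k w)"
    unfolding psum_init_seg pproj_def using init_seg_subset by (intro ext sum.cong) auto
  then show "psum (Gam l) ?c e \<longlonglongrightarrow> w" using pproj_tendsto by simp
  show "g \<notin> Gam l \<Longrightarrow> ?c g = 0" for g by simp
  fix c assume c: "(\<forall>g. g \<notin> Gam l \<longrightarrow> c g = 0) \<and> psum (Gam l) c e \<longlonglongrightarrow> w"
  show "c = ?c"
  proof
    fix g
    show "c g = ?c g"
    proof (cases "g \<in> Gam l")
      case True
      have "blinfun_apply (dual_basis g) (psum (Gam l) c e k) = c g" if "g \<in> init_seg l k" for k
      proof -
        have "blinfun_apply (dual_basis g) (psum (Gam l) c e k) = (\<Sum>d\<in>init_seg l k. if d = g then c g else 0)"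
          unfolding psum_init_seg blinfun.sum_right using init_seg_subset True
          by (intro sum.cong) (auto simp: blinfun.scaleR_right dual_basis_e subset_eq)
        then show ?thesis using that by (simp add: finite_init_seg)
      qed
      then have "(\<lambda>k. blinfun_apply (dual_basis g) (psum (Gam l) c e k)) \<longlonglongrightarrow> c g"
        using eventually_init_seg[OF True] by (intro tendsto_eventually) (auto elim: eventually_mono)
      moreover have "(\<lambda>k. blinfun_apply (dual_basis g) (psum (Gam l) c e k)) \<longlonglongrightarrow> blinfun_apply (dual_basis g) w"
        using c by (intro tendsto_intros) auto
      ultimately show ?thesis using True LIMSEQ_unique by auto
    qed (simp add: c)
  qed
qed

text \<open>The set of functionals \<open>bfun a ii\<close> is weak-star sequentially compact, because each
  \<open>a n\<close> is bounded and each \<open>ii n\<close> has finitely many values.\<close>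
lemma norming_bfun: "\<exists>a ii. adm l x a ii \<and> blinfun_apply (bfun a ii) w = norm w"
proof -
  \<comment> \<open>A pair that almost norms \<open>pproj k w\<close> has, once truncated to the
    initial segment, the same value at \<open>w\<close>. All the approximating functionals can thus
    be evaluated at one vector.\<close>
  have "\<exists>a ii. adm l x a ii \<and> norm (pproj k w) - 1 / Suc k < blinfun_apply (bfun a ii) w" for k
  proof -
    have "\<exists>a ii. adm l x a ii \<and> norm (pproj k w) - 1 / Suc k
        < (\<Sum>g\<in>init_seg l k. blinfun_apply (dual_basis g) w * selcoef a ii g)"
    proof (rule ccontr)
      assume "\<not> ?thesis"
      then have "norm (pproj k w) \<le> norm (pproj k w) - 1 / Suc k"
        unfolding pproj_def[of k w] by (intro norm_le_adm_sum finite_init_seg init_seg_subset) (auto simp: not_less)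
      then show False by simp
    qed
    then obtain a ii where adm: "adm l x a ii" and "norm (pproj k w) - 1 / Suc k
        < (\<Sum>g\<in>init_seg l k. blinfun_apply (dual_basis g) w * selcoef a ii g)"
      by blast
    moreover obtain N where "\<And>n. (n, ii n) \<in> init_seg l k \<longleftrightarrow> n < N"
      "\<And>w. blinfun_apply (bfun a ii) (pproj k w) = blinfun_apply (bfun (\<lambda>n. if n < N then a n else 0) ii) w"
      using init_seg_truncates[OF adm, of k] by blast
    ultimately have "norm (pproj k w) - 1 / Suc k < blinfun_apply (bfun (\<lambda>n. if n < N then a n else 0) ii) w"
      by (simp add: bfun_pproj[OF adm, symmetric])
    then show ?thesis using adm_truncate[OF adm] by blast
  qed
  then obtain A I where adm: "\<And>k. adm l x (A k) (I k)"
    and near: "\<And>k. norm (pproj k w) - 1 / Suc k < blinfun_apply (bfun (A k) (I k)) w"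
    by metis
  define K where "K = (\<lambda>n. \<Sum>i\<in>{1..l n}. 1 / norm (x n i))"
  have K: "1 / norm (x n i) \<le> K n" if "1 \<le> i" "i \<le> l n" for n i
    unfolding K_def using that by (intro member_le_sum[where f = "\<lambda>i. 1 / norm (x n i)"]) auto
  have K_pos: "K n > 0" for n
    proof -
    have "0 < 1 / norm (x n 1)" using l_pos[of n] x_nonzero[of 1 n] by simp
    also have "\<dots> \<le> K n" using K[of 1 n] l_pos[of n] by simp
    finally show ?thesis .
  qed
  \<comment> \<open>Coefficient and index are joined in one pair, so that a single diagonal
    extraction handles both; \<open>K n\<close> and \<open>l n\<close> scale them to a bound that is
    uniform in \<open>n\<close>.\<close>
  define f where "f = (\<lambda>k n. (A k n / K n, real (I k n) / real (l n)))"
  have f_le: "norm (f k n) \<le> 2" for k n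
  proof -
    have "\<bar>A k n\<bar> \<le> K n"
      using adm_coeff_le[OF adm, of k n] K[of "I k n" n] adm_sel[OF adm, of k] by (meson order_trans)
    then have "norm (A k n / K n) \<le> 1" using K_pos[of n] by simp
    moreover have "norm (real (I k n) / real (l n)) \<le> 1" using adm_sel[OF adm, of k] l_pos[of n] by (simp add: divide_le_eq_1)
    ultimately show ?thesis unfolding f_def
      using norm_Pair_le[of "A k n / K n" "real (I k n) / real (l n)"] by linarith
  qed
  obtain r where r: "strict_mono r" "\<And>n. \<exists>L. (\<lambda>k. f (r k) n) \<longlonglongrightarrow> L"
  proof (rule function_convergent_subsequence[of UNIV f 2])
    fix r assume "strict_mono r" and lim: "\<And>n. n \<in> UNIV \<Longrightarrow> \<exists>L. (\<lambda>k. f (r k) n) \<longlonglongrightarrow> L"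
    then show thesis using lim[OF UNIV_I] by (intro that)
  qed (simp_all add: f_le)
  have "\<exists>a. (\<lambda>k. A (r k) n) \<longlonglongrightarrow> a" for n
  proof -
    obtain L where "(\<lambda>k. f (r k) n) \<longlonglongrightarrow> L" using r by blast
    then have "(\<lambda>k. fst (f (r k) n) * K n) \<longlonglongrightarrow> fst L * K n"
      by (intro tendsto_mult_right tendsto_fst)
    then have "(\<lambda>k. A (r k) n) \<longlonglongrightarrow> fst L * K n"
      using K_pos[of n] by (simp add: f_def)
    then show ?thesis ..
  qed
  then obtain a where a: "\<And>n. (\<lambda>k. A (r k) n) \<longlonglongrightarrow> a n" by metis
  have "\<exists>i. \<forall>\<^sub>F k in sequentially. I (r k) n = i" for n
  proof -
    obtain L where "(\<lambda>k. f (r k) n) \<longlonglongrightarrow> L" using r by blast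
    then have "(\<lambda>k. snd (f (r k) n) * real (l n)) \<longlonglongrightarrow> snd L * real (l n)"
      by (intro tendsto_mult_right tendsto_snd)
    then have "(\<lambda>k. real (I (r k) n)) \<longlonglongrightarrow> snd L * real (l n)"
      using l_pos[of n] by (simp add: f_def)
    then show ?thesis by (rule LIMSEQ_real_of_nat_eventually_const) blast
  qed
  then obtain ii where ii: "\<And>n. \<forall>\<^sub>F k in sequentially. I (r k) n = ii n" by metis
  have lim_adm: "adm l x a ii"
    using adm a ii by (rule adm_limit[where a' = "\<lambda>k. A (r k)" and ii' = "\<lambda>k. I (r k)"])
  have "(\<lambda>k. blinfun_apply (bfun (A (r k)) (I (r k))) w) \<longlonglongrightarrow> blinfun_apply (bfun a ii) w"
  proof (rule tendsto_on_dense_span[where T = "\<lambda>k. blinfun_apply (bfun (A (r k)) (I (r k)))"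
        and L = "blinfun_apply (bfun a ii)" and D = "e ` Gam l"])
    show "(\<lambda>k. blinfun_apply (bfun (A (r k)) (I (r k))) d) \<longlonglongrightarrow> blinfun_apply (bfun a ii) d"
      if "d \<in> e ` Gam l" for d
    proof -
      obtain g where g: "g \<in> Gam l" "d = e g" using \<open>d \<in> e ` Gam l\<close> by blast
      have "(\<lambda>k. if snd g = I (r k) (fst g) then A (r k) (fst g) else 0) \<longlonglongrightarrow> selcoef a ii g"
      proof (cases "snd g = ii (fst g)")
        case True
        show ?thesis
          by (rule Lim_transform_eventually[OF a[of "fst g", THEN tendsto_eq_rhs]])
            (use True ii[of "fst g"] in \<open>auto simp: selcoef_def elim: eventually_mono\<close>)
      next
        case False
        show ?thesis
          by (rule tendsto_eventually) (use False ii[of "fst g"] in \<open>auto simp: selcoef_def elim: eventually_mono\<close>)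
      qed
      then show ?thesis using g lim_adm adm by (simp add: bfun_e selcoef_def)
    qed
  qed (use W_dense bfun_le_norm[OF adm] bfun_le_norm[OF lim_adm] in
      \<open>auto simp: bounded_linear.linear blinfun.bounded_linear_right\<close>)
  moreover have "(\<lambda>k. norm (pproj (r k) w) - 1 / Suc (r k)) \<longlonglongrightarrow> norm w - 0"
    using LIMSEQ_subseq_LIMSEQ[OF tendsto_norm[OF pproj_tendsto[of w]] r(1)]
      LIMSEQ_subseq_LIMSEQ[OF LIMSEQ_inverse_real_of_nat r(1)]
    by (intro tendsto_diff) (simp_all add: o_def inverse_eq_divide)
  ultimately have "norm w - 0 \<le> blinfun_apply (bfun a ii) w"
    using near by (intro LIMSEQ_le) (auto intro: less_imp_le)
  then show ?thesis using bfun_le_norm[OF lim_adm, of w] lim_adm by force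
qed

section \<open>Unconditionality and the isometric embedding\<close>

lemma uncond_basis_e:
  assumes "unconditional_FDD V"
  shows "uncond_basis (Gam l) e"
  unfolding uncond_basis_def
proof (intro allI impI)
  have le: "norm (\<Sum>g\<in>F. (\<sigma> g * c g) *\<^sub>R e g) \<le> norm (\<Sum>g\<in>F. c g *\<^sub>R e g)"
    if F: "finite F" "F \<subseteq> Gam l" and \<sigma>: "\<And>g. \<sigma> g = 1 \<or> \<sigma> g = (-1::real)" for F c \<sigma>
  proof (rule norm_le_adm_sum[OF F])
    fix a ii assume adm: "adm l x a ii"
    \<comment> \<open>Along a selection only the signs \<open>\<sigma> (n, ii n)\<close> are seen.
      They form a sign sequence on the levels, to which the unconditionality of the FDD
      applies.\<close>
    have "(\<Sum>g\<in>F. \<sigma> g * c g * selcoef a ii g) = (\<Sum>g\<in>F. c g * selcoef (\<lambda>n. \<sigma> (n, ii n) * a n) ii g)"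
      by (intro sum.cong) (auto simp: selcoef_def)
    also have "\<dots> \<le> norm (\<Sum>g\<in>F. c g *\<^sub>R e g)"
      using adm_signs[OF assms adm, of "\<lambda>n. \<sigma> (n, ii n)"] \<sigma> by (intro adm_sum_le_norm F) auto
    finally show "(\<Sum>g\<in>F. \<sigma> g * c g * selcoef a ii g) \<le> norm (\<Sum>g\<in>F. c g *\<^sub>R e g)" .
  qed
  fix F c and \<sigma> :: "nat \<times> nat \<Rightarrow> real"
  assume F: "finite F" "F \<subseteq> Gam l" and \<sigma>: "\<forall>g. \<sigma> g = 1 \<or> \<sigma> g = -1"
  have "\<sigma> g * (\<sigma> g * c g) = c g" for g using \<sigma>[rule_format, of g] by auto
  then have "norm (\<Sum>g\<in>F. c g *\<^sub>R e g) \<le> norm (\<Sum>g\<in>F. (\<sigma> g * c g) *\<^sub>R e g)"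
    using le[OF F, of \<sigma> "\<lambda>g. \<sigma> g * c g"] \<sigma> by (simp only:)
  then show "norm (\<Sum>g\<in>F. (\<sigma> g * c g) *\<^sub>R e g) = norm (\<Sum>g\<in>F. c g *\<^sub>R e g)"
    using le[OF F, of \<sigma> c] \<sigma> by (intro antisym) simp_all
qed

text \<open>Pairing the image of a block of \<open>v\<close> with an admissible functional collapses
  the sum over \<open>i\<close> to the selected index and leaves the corresponding block in V. So
  both norms are suprema of the same numbers, and blocks do not grow under the map, which gives
  convergence.\<close>

lemma embedding:
  "\<exists>J :: 'v \<Rightarrow> 'w. linear J \<and> (\<forall>v. norm (J v) = tnorm l x v) \<and>
     (\<forall>v. (\<lambda>N. \<Sum>n<N. \<Sum>i=1..l n. blinfun_apply (x n i) (coord V n v) *\<^sub>R e (n, i)) \<longlonglongrightarrow> J v)"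
proof -
  define G where "G = (\<lambda>p q. SIGMA n:{p..<q}. {1..l n})"
  define j where "j = (\<lambda>A v. \<Sum>n\<in>A. \<Sum>i=1..l n. blinfun_apply (x n i) (coord V n v) *\<^sub>R e (n, i))"
  have G: "finite (G p q)" "G p q \<subseteq> Gam l" for p q by (auto simp: G_def Gam_def)
  have j_G: "j {p..<q} v = (\<Sum>g\<in>G p q. blinfun_apply (x (fst g) (snd g)) v *\<^sub>R e g)" for p q v
    unfolding j_def G_def
    by (subst sum.Sigma) (auto simp: split_beta dual_comp_apply[OF x_dual] intro!: sum.cong)
  have pair: "(\<Sum>g\<in>G p q. blinfun_apply (x (fst g) (snd g)) v * selcoef a ii g)
      = (\<Sum>n\<in>{p..<q}. a n * blinfun_apply (x n (ii n)) v)" if "adm l x a ii" for p q a ii v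
  proof -
    have "{n. (n, ii n) \<in> G p q} = {p..<q}" using adm_sel[OF that] by (auto simp: G_def)
    then show ?thesis by (simp add: sum_selcoef_finite[OF G(1)])
  qed
  have j_le: "norm (j {p..<q} v) \<le> norm (proj {p..<q} v)" for p q v
    unfolding j_G
  proof (rule norm_le_adm_sum[OF G])
    fix a ii assume adm: "adm l x a ii"
    show "(\<Sum>g\<in>G p q. blinfun_apply (x (fst g) (snd g)) v * selcoef a ii g) \<le> norm (proj {p..<q} v)"
      unfolding pair[OF adm] using adm_block[OF adm, where p = p and q = q and v = v] by linarith
  qed
  have j_diff: "j {..<q} v - j {..<p} v = j {p..<q} v" if "p \<le> q" for p q v
  proof -
    have "j {0..<p} v + j {p..<q} v = j {0..<q} v"
      unfolding j_def using that by (intro sum.atLeastLessThan_concat) auto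
    then show ?thesis by (simp add: atLeast0LessThan algebra_simps)
  qed
  have "Cauchy (\<lambda>N. j {..<N} v)" for v
  proof (rule CauchyI)
    fix \<delta> :: real assume "\<delta> > 0"
    then obtain M where M: "\<And>p q. M \<le> p \<Longrightarrow> p \<le> q \<Longrightarrow> norm (proj {p..<q} v) < \<delta>"
      using proj_block_small by blast
    have small: "norm (j {..<q} v - j {..<p} v) < \<delta>" if "M \<le> p" "p \<le> q" for p q
      using j_le[where p = p and q = q and v = v] M[OF that] j_diff[OF that(2), of v] by simp
    have "norm (j {..<m} v - j {..<n} v) < \<delta>" if "M \<le> m" "M \<le> n" for m n
      using small[of n m] small[of m n] that by (cases "n \<le> m") (auto simp: norm_minus_commute)
    then show "\<exists>M. \<forall>m\<ge>M. \<forall>n\<ge>M. norm (j {..<m} v - j {..<n} v) < \<delta>" by blast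
  qed
  then have "\<exists>L. (\<lambda>N. j {..<N} v) \<longlonglongrightarrow> L" for v
    by (simp add: Cauchy_convergent_iff convergent_def)
  then obtain J where J: "\<And>v. (\<lambda>N. j {..<N} v) \<longlonglongrightarrow> J v" by metis
  have j_add: "j A (u + v) = j A u + j A v" for A u v
    by (simp add: j_def linear_add[OF linear_coord] blinfun.add_right scaleR_add_left sum.distrib)
  have j_scale: "j A (t *\<^sub>R v) = t *\<^sub>R j A v" for A t v
    by (simp add: j_def linear_scale[OF linear_coord] blinfun.scaleR_right scaleR_sum_right)
  have "linear J"
  proof
    show "J (u + v) = J u + J v" for u v
      by (rule LIMSEQ_unique[OF J[of "u + v"]]) (unfold j_add, rule tendsto_add[OF J J])
    show "J (t *\<^sub>R v) = t *\<^sub>R J v" for t v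
      by (rule LIMSEQ_unique[OF J[of "t *\<^sub>R v"]]) (unfold j_scale, rule tendsto_scaleR[OF tendsto_const J])
  qed
  moreover have "norm (J v) = tnorm l x v" for v
  proof (rule antisym)
    have "norm (j {0..<N} v) \<le> tnorm l x v" for N
      unfolding j_G
    proof (rule norm_le_adm_sum[OF G])
      fix a ii assume adm: "adm l x a ii"
      \<comment> \<open>Truncated pairs are admissible, so partial sums are already bounded by
        \<open>tnorm l x v\<close>.\<close>
      have "(\<Sum>n\<in>{0..<N}. a n * blinfun_apply (x n (ii n)) v)
          = (\<Sum>n. (if n < N then a n else 0) * blinfun_apply (x n (ii n)) v)"
        by (subst suminf_finite[of "{0..<N}"]) auto
      also have "\<dots> \<le> tnorm l x v" by (rule order_trans[OF abs_ge_self tnorm_upper[OF adm_truncate[OF adm]]])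
      finally show "(\<Sum>g\<in>G 0 N. blinfun_apply (x (fst g) (snd g)) v * selcoef a ii g) \<le> tnorm l x v"
        by (simp add: pair[OF adm])
    qed
    then show "norm (J v) \<le> tnorm l x v"
      by (intro LIMSEQ_le_const2[OF tendsto_norm[OF J]]) (simp add: atLeast0LessThan)
    have "(\<Sum>n. a n * blinfun_apply (x n (ii n)) v) \<le> norm (J v)" if adm: "adm l x a ii" for a ii
    proof (rule LIMSEQ_le[OF adm_sums[OF adm] tendsto_norm[OF J]])
      show "\<exists>M. \<forall>N\<ge>M. (\<Sum>n<N. a n * blinfun_apply (x n (ii n)) v) \<le> norm (j {..<N} v)"
      proof (intro exI allI impI)
        fix N
        have "(\<Sum>g\<in>G 0 N. blinfun_apply (x (fst g) (snd g)) v * selcoef a ii g) \<le> norm (j {0..<N} v)"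
          unfolding j_G by (rule adm_sum_le_norm[OF G adm])
        then show "(\<Sum>n<N. a n * blinfun_apply (x n (ii n)) v) \<le> norm (j {..<N} v)"
          by (simp add: pair[OF adm] atLeast0LessThan)
      qed
    qed
    note le = this
    show "tnorm l x v \<le> norm (J v)"
    proof (rule tnorm_least)
      fix a ii assume adm: "adm l x a ii"
      have "summable (\<lambda>n. a n * blinfun_apply (x n (ii n)) v)" using adm by (simp add: adm_def)
      then have "- (\<Sum>n. a n * blinfun_apply (x n (ii n)) v) \<le> norm (J v)"
        using le[OF adm_uminus[OF adm]] by (simp add: suminf_minus)
      then show "\<bar>\<Sum>n. a n * blinfun_apply (x n (ii n)) v\<bar> \<le> norm (J v)"
        using le[OF adm] by simp
    qed
  qed
  ultimately show ?thesis using J unfolding j_def by (intro exI[of _ J]) simp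
qed

section \<open>Shrinkingness\<close>

lemma shrinking_bfun_tail:
  assumes shr: "shrinking_FDD V" and adm: "adm l x a ii" and "\<delta> > 0"
  obtains M where "\<And>N w. N \<ge> M \<Longrightarrow>
    \<bar>blinfun_apply (bfun a ii) w - blinfun_apply (bfun (\<lambda>n. if n < N then a n else 0) ii) w\<bar> \<le> \<delta> * norm w"
proof -
  obtain \<phi> :: "'v \<Rightarrow>\<^sub>L real" where
    \<phi>: "\<And>p q v. blinfun_apply \<phi> (proj {p..<q} v) = (\<Sum>n\<in>{p..<q}. a n * blinfun_apply (x n (ii n)) v)"
    using adm_functional[OF adm] by blast
  obtain M where M: "\<And>N. N \<ge> M \<Longrightarrow> norm ((\<phi> o\<^sub>L proj_blinfun N) - \<phi>) < \<delta>"
    using LIMSEQ_D[OF shrinking_tail[OF shr, of \<phi>] \<open>\<delta> > 0\<close>] by blast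
  have "\<bar>blinfun_apply (bfun a ii) w - blinfun_apply (bfun (\<lambda>n. if n < N then a n else 0) ii) w\<bar> \<le> \<delta> * norm w"
    if "N \<ge> M" for N w
  proof -
    \<comment> \<open>Beyond level \<open>M\<close> the tail of \<open>\<phi>\<close> has norm below
      \<open>\<delta>\<close> on V. The tail of \<open>a\<close> divided by \<open>\<delta>\<close>
      is therefore admissible, and its functional on W has norm at most 1.\<close>
    define b where "b = (\<lambda>n. if n < N then 0 else a n / \<delta>)"
    have b_adm: "adm l x b ii"
      unfolding adm_iff
    proof (intro conjI allI)
      fix K v
      have "(\<Sum>n<K. b n * blinfun_apply (x n (ii n)) v) = (\<Sum>n\<in>{N..<K}. a n * blinfun_apply (x n (ii n)) v) / \<delta>"
        unfolding sum_divide_distrib b_def by (intro sum.mono_neutral_cong_right) auto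
      also have "(\<Sum>n\<in>{N..<K}. a n * blinfun_apply (x n (ii n)) v) = - blinfun_apply ((\<phi> o\<^sub>L proj_blinfun N) - \<phi>) (proj {N..<K} v)"
      proof -
        have "coord V n (proj {N..<K} v) = 0" if "n < N" for n using that by (simp add: coord_proj)
        then have "proj {..<N} (proj {N..<K} v) = 0" by simp
        then show ?thesis by (simp add: minus_blinfun.rep_eq proj_blinfun_apply blinfun.zero_right \<phi>)
      qed
      also have "\<bar>- blinfun_apply ((\<phi> o\<^sub>L proj_blinfun N) - \<phi>) (proj {N..<K} v) / \<delta>\<bar> \<le> norm v"
      proof -
        have "norm (blinfun_apply ((\<phi> o\<^sub>L proj_blinfun N) - \<phi>) (proj {N..<K} v)) \<le> \<delta> * norm v"
          using norm_blinfun[of "(\<phi> o\<^sub>L proj_blinfun N) - \<phi>" "proj {N..<K} v"]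
            mult_mono[OF less_imp_le[OF M[OF that]] norm_proj_le[of v N K]] \<open>\<delta> > 0\<close>
          by (meson less_imp_le norm_ge_zero order_trans)
        then show ?thesis using \<open>\<delta> > 0\<close> by (simp add: field_simps)
      qed
      finally show "\<bar>\<Sum>n<K. b n * blinfun_apply (x n (ii n)) v\<bar> \<le> norm v" .
    qed (use adm_sel[OF adm] in auto)
    have "bfun a ii - bfun (\<lambda>n. if n < N then a n else 0) ii = \<delta> *\<^sub>R bfun b ii"
    proof (rule blinfun_eqI_basis)
      show "blinfun_apply (bfun a ii - bfun (\<lambda>n. if n < N then a n else 0) ii) (e g) = blinfun_apply (\<delta> *\<^sub>R bfun b ii) (e g)"
        if "g \<in> Gam l" for g
        using that adm b_adm adm_truncate[OF adm] \<open>\<delta> > 0\<close>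
        by (simp add: minus_blinfun.rep_eq scaleR_blinfun.rep_eq bfun_e selcoef_def b_def)
    qed
    from arg_cong[OF this, of "\<lambda>f. blinfun_apply f w"]
    have "blinfun_apply (bfun a ii) w - blinfun_apply (bfun (\<lambda>n. if n < N then a n else 0) ii) w = \<delta> * blinfun_apply (bfun b ii) w"
      by (simp add: minus_blinfun.rep_eq scaleR_blinfun.rep_eq)
    then show ?thesis
      using bfun_le_norm[OF b_adm, of w] \<open>\<delta> > 0\<close> by (simp add: abs_mult)
  qed
  then show ?thesis using that by blast
qed

text \<open>As \<open>k\<close> grows, the level at which the \<open>k\<close>-th segment cuts
  \<open>ii\<close> tends to infinity. The tail estimate is uniform on the unit ball, so the vector
  may change with \<open>k\<close>.\<close>

lemma bfun_pproj_uniform: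
  assumes shr: "shrinking_FDD V" and adm: "adm l x a ii" and bdd: "\<And>k. norm (w k) \<le> 1"
  shows "(\<lambda>k. blinfun_apply (bfun a ii) (w k - pproj k (w k))) \<longlonglongrightarrow> 0"
proof (rule LIMSEQ_I)
  fix r :: real assume "r > 0"
  obtain M where M: "\<And>N w. N \<ge> M \<Longrightarrow>
    \<bar>blinfun_apply (bfun a ii) w - blinfun_apply (bfun (\<lambda>n. if n < N then a n else 0) ii) w\<bar> \<le> r / 2 * norm w"
    using shrinking_bfun_tail[OF shr adm, of "r / 2"] \<open>r > 0\<close> by auto
  obtain k0 where k0: "\<And>k. k \<ge> k0 \<Longrightarrow> {g \<in> Gam l. fst g < M} \<subseteq> init_seg l k"
    using eventually_init_seg_levels[of l M] by (auto simp: eventually_sequentially)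
  have "norm (blinfun_apply (bfun a ii) (w k - pproj k (w k)) - 0) < r" if "k \<ge> k0" for k
  proof -
    obtain N where N: "\<And>n. (n, ii n) \<in> init_seg l k \<longleftrightarrow> n < N"
      "\<And>w. blinfun_apply (bfun a ii) (pproj k w) = blinfun_apply (bfun (\<lambda>n. if n < N then a n else 0) ii) w"
      using init_seg_truncates[OF adm, of k] by blast
    have "N \<ge> M"
    proof (rule ccontr)
      assume "\<not> N \<ge> M"
      then have "(N, ii N) \<in> init_seg l k"
        using k0[OF \<open>k \<ge> k0\<close>] sel_Gam[OF adm_sel[OF adm], of N] by auto
      then show False using N(1)[of N] by simp
    qed
    then have "\<bar>blinfun_apply (bfun a ii) (w k - pproj k (w k))\<bar> \<le> r / 2 * norm (w k)"
      using M by (simp add: blinfun.diff_right N(2))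
    also have "\<dots> \<le> r / 2 * 1" using bdd[of k] \<open>r > 0\<close> by (intro mult_left_mono) auto
    finally show ?thesis using \<open>r > 0\<close> by simp
  qed
  then show "\<exists>k0. \<forall>k\<ge>k0. norm (blinfun_apply (bfun a ii) (w k - pproj k (w k)) - 0) < r" by blast
qed

text \<open>\<open>h k\<close> is \<open>f\<close> composed with \<open>pproj k\<close>. Choosing
  \<open>w k\<close> where \<open>f - h k\<close> is at least half its norm reduces norm convergence
  to a statement about \<open>f\<close> on the bounded sequence \<open>w k - pproj k (w k)\<close>.
  Admissible functionals tend to 0 on it, and they form a boundary.\<close>

lemma shrinking_basis_e:
  assumes shr: "shrinking_FDD V"
  shows "shrinking_basis (Gam l) e"
proof -
  let ?D = "{f :: 'w \<Rightarrow>\<^sub>L real. \<exists>g\<in>Gam l. \<forall>d\<in>Gam l. blinfun_apply f (e d) = (if d = g then 1 else 0)}"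
  have "f \<in> closure (span ?D)" for f :: "'w \<Rightarrow>\<^sub>L real"
  proof -
    define h where "h = (\<lambda>k. \<Sum>g\<in>init_seg l k. blinfun_apply f (e g) *\<^sub>R dual_basis g)"
    have h_span: "h k \<in> span ?D" for k
      unfolding h_def
    proof (intro span_sum span_scale span_base)
      fix g assume "g \<in> init_seg l k"
      then have "g \<in> Gam l" using init_seg_subset by blast
      then show "dual_basis g \<in> ?D" using dual_basis_e by blast
    qed
    have h_apply: "blinfun_apply (h k) w = blinfun_apply f (pproj k w)" for k w
      by (simp add: h_def pproj_def blinfun.sum_left blinfun.sum_right scaleR_blinfun.rep_eq blinfun.scaleR_right mult.commute)
    obtain w where w: "\<And>k. norm (w k) \<le> 1" "\<And>k. norm (f - h k) / 2 \<le> \<bar>blinfun_apply (f - h k) (w k)\<bar>"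
    proof -
      have "\<exists>w. \<forall>k. norm (w k) \<le> 1 \<and> norm (f - h k) / 2 \<le> \<bar>blinfun_apply (f - h k) (w k)\<bar>"
        by (rule choice) (use blinfun_almost_norming in blast)
      then show ?thesis using that by blast
    qed
    let ?B = "{bfun a ii | a ii. adm l x a ii}"
    have "(\<lambda>k. blinfun_apply f (w k - pproj k (w k))) \<longlonglongrightarrow> 0"
    proof (rule boundary_null_imp_weakly_null[where B = ?B and K = 2])
      show "\<exists>b\<in>?B. norm b \<le> 1 \<and> blinfun_apply b w = norm w" for w
      proof -
        obtain a ii where "adm l x a ii" "blinfun_apply (bfun a ii) w = norm w"
          using norming_bfun[of w] by blast
        then show ?thesis using norm_bfun[of a ii] by blast
      qed
      show "norm (w k - pproj k (w k)) \<le> 2" for k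
        using norm_triangle_ineq4[of "w k" "pproj k (w k)"] norm_pproj_le[of k "w k"] w(1)[of k] by linarith
      show "(\<lambda>k. blinfun_apply b (w k - pproj k (w k))) \<longlonglongrightarrow> 0" if "b \<in> ?B" for b
      proof -
        obtain a ii where "b = bfun a ii" "adm l x a ii" using \<open>b \<in> ?B\<close> by blast
        then show ?thesis using bfun_pproj_uniform[OF shr _ w(1)] by simp
      qed
    qed
    then have "(\<lambda>k. 2 * \<bar>blinfun_apply f (w k - pproj k (w k))\<bar>) \<longlonglongrightarrow> 2 * \<bar>0\<bar>"
      by (intro tendsto_mult tendsto_const tendsto_rabs)
    then have null: "(\<lambda>k. 2 * \<bar>blinfun_apply f (w k - pproj k (w k))\<bar>) \<longlonglongrightarrow> 0" by simp
    have "norm (h k - f) \<le> 2 * \<bar>blinfun_apply f (w k - pproj k (w k))\<bar>" for k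
      using w(2)[of k] by (simp add: minus_blinfun.rep_eq h_apply blinfun.diff_right norm_minus_commute)
    then have "(\<lambda>k. h k - f) \<longlonglongrightarrow> 0"
      by (intro Lim_null_comparison[OF _ null] always_eventually allI)
    then have "h \<longlonglongrightarrow> f" by (rule LIM_zero_cancel)
    with h_span show ?thesis unfolding closure_sequential by (intro exI[of _ h]) simp
  qed
  then have "closure (span ?D) = UNIV" by blast
  then show ?thesis by (simp add: shrinking_basis_def)
qed

section \<open>Bounded completeness\<close>

lemma sum_init_seg_selcoef:
  assumes "\<And>n. (n, ii n) \<in> init_seg l k \<longleftrightarrow> n < N"
  shows "(\<Sum>g\<in>init_seg l k. c g * selcoef a ii g) = (\<Sum>n<N. a n * c (n, ii n))"
  using sum_selcoef_finite[OF finite_init_seg, of c a ii] assms by (simp add: lessThan_def)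

text \<open>The difference of two initial segments meets a selection in a block of levels. If the
  smaller segment already contains all levels below \<open>M\<close>, the block starts at
  \<open>M\<close> or later, so further blocks can be chosen on fresh levels.\<close>

lemma psum_not_Cauchy_blocks:
  assumes "\<not> convergent (psum (Gam l) c e)"
  shows "\<exists>\<eta>>0. \<forall>M. \<exists>p q a ii. M \<le> p \<and> p \<le> q \<and> adm l x a ii \<and> \<eta> < (\<Sum>n\<in>{p..<q}. a n * c (n, ii n))"
proof -
  have "\<not> Cauchy (psum (Gam l) c e)" using assms Cauchy_convergent by blast
  then obtain \<eta> where "\<eta> > 0"
    and osc: "\<And>K. \<exists>m n. m \<ge> K \<and> n \<ge> K \<and> \<eta> \<le> norm (psum (Gam l) c e m - psum (Gam l) c e n)"
    by (simp only: Cauchy_iff not_all not_ex not_imp not_less) blast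
  have "\<exists>p q a ii. M \<le> p \<and> p \<le> q \<and> adm l x a ii \<and> \<eta> / 2 < (\<Sum>n\<in>{p..<q}. a n * c (n, ii n))" for M
  proof -
    obtain K where K: "\<And>k. k \<ge> K \<Longrightarrow> {g \<in> Gam l. fst g < M} \<subseteq> init_seg l k"
      using eventually_init_seg_levels[of l M] by (auto simp: eventually_sequentially)
    obtain m n where mn: "n \<ge> K" "n \<le> m" "\<eta> \<le> norm (psum (Gam l) c e m - psum (Gam l) c e n)"
    proof -
      obtain m n where mn: "m \<ge> K" "n \<ge> K" "\<eta> \<le> norm (psum (Gam l) c e m - psum (Gam l) c e n)"
        using osc[of K] by blast
      show ?thesis
      proof (cases "n \<le> m")
        case True
        with mn show ?thesis by (intro that)
      next
        case False
        with mn show ?thesis by (intro that[of m n]) (simp_all add: norm_minus_commute)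
      qed
    qed
    let ?F = "init_seg l m - init_seg l n"
    have F: "finite ?F" "?F \<subseteq> Gam l" using finite_init_seg init_seg_subset by (blast intro: finite_Diff)+
    have "psum (Gam l) c e m - psum (Gam l) c e n = (\<Sum>g\<in>?F. c g *\<^sub>R e g)"
      unfolding psum_init_seg using init_seg_mono[OF mn(2)] by (simp add: sum_diff finite_init_seg)
    then have "\<not> norm (\<Sum>g\<in>?F. c g *\<^sub>R e g) \<le> \<eta> / 2" using mn(3) \<open>\<eta> > 0\<close> by simp
    then have "\<exists>a ii. adm l x a ii \<and> \<not> (\<Sum>g\<in>?F. c g * selcoef a ii g) \<le> \<eta> / 2"
      using norm_le_adm_sum[OF F, of c "\<eta> / 2"] by blast
    then obtain a ii where adm: "adm l x a ii" and big: "\<eta> / 2 < (\<Sum>g\<in>?F. c g * selcoef a ii g)"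
      by (auto simp: not_le)
    obtain p where p: "\<And>j. (j, ii j) \<in> init_seg l n \<longleftrightarrow> j < p"
      using init_seg_section[of ii l n] sel_Gam[OF adm_sel[OF adm]] by blast
    obtain q where q: "\<And>j. (j, ii j) \<in> init_seg l m \<longleftrightarrow> j < q"
      using init_seg_section[of ii l m] sel_Gam[OF adm_sel[OF adm]] by blast
    have "p \<le> q"
    proof (rule ccontr)
      assume "\<not> p \<le> q"
      then have "(q, ii q) \<in> init_seg l n" using p[of q] by simp
      then have "(q, ii q) \<in> init_seg l m" by (rule subsetD[OF init_seg_mono[OF mn(2)]])
      then show False using q[of q] by simp
    qed
    have "M \<le> p"
    proof (rule ccontr)
      assume "\<not> M \<le> p"
      then have "(p, ii p) \<in> init_seg l n"
        using K[OF mn(1)] sel_Gam[OF adm_sel[OF adm], of p] by auto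
      then show False using p[of p] by simp
    qed
    have "(\<Sum>g\<in>?F. c g * selcoef a ii g) = (\<Sum>j\<in>{p..<q}. a j * c (j, ii j))"
    proof -
      have "{j. (j, ii j) \<in> ?F} = {p..<q}" by (auto simp: p q)
      then show ?thesis by (simp add: sum_selcoef_finite[OF F(1)])
    qed
    with big have "\<eta> / 2 < (\<Sum>j\<in>{p..<q}. a j * c (j, ii j))" by simp
    with adm \<open>M \<le> p\<close> \<open>p \<le> q\<close> show ?thesis by blast
  qed
  with \<open>\<eta> > 0\<close> show ?thesis by (intro exI[of _ "\<eta> / 2"]) simp
qed

text \<open>Along one selection \<open>ii\<close>, bounded partial sums make \<open>x n (ii n) \<mapsto> c (n, ii n)\<close> a bounded
  functional on the span, which extends to the dual of \<open>V\<close> and is evaluation at some \<open>v\<close> by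
  reflexivity.\<close>
lemma reflexive_represents_selection:
  assumes refl: "reflexive TYPE('v)" and sel: "sel ii"
    and bdd: "\<And>k. norm (psum (Gam l) c e k) \<le> M"
  obtains v where "\<And>n. blinfun_apply (x n (ii n)) v = c (n, ii n)"
proof -
  have M: "M \<ge> 0" using bdd[of 0] norm_ge_zero order_trans by blast
  have bound: "(\<Sum>n\<in>F. a n * c (n, ii n)) \<le> M * norm (\<Sum>n\<in>F. a n *\<^sub>R x n (ii n))"
    if F: "finite F" for F a
  proof (rule field_le_epsilon)
    fix \<delta> :: real assume "\<delta> > 0"
    let ?f = "\<Sum>n\<in>F. a n *\<^sub>R x n (ii n)"
    \<comment> \<open>The slack keeps \<open>t\<close> positive when \<open>?f\<close> is zero.
      Dividing by \<open>M + 1\<close> covers \<open>M = 0\<close> and lets \<open>M * t\<close>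
      exceed \<open>M * norm ?f\<close> by at most \<open>\<delta>\<close>.\<close>
    define t where "t = norm ?f + \<delta> / (M + 1)"
    have t: "t > 0" "norm ?f \<le> t" using \<open>\<delta> > 0\<close> M by (auto simp: t_def add_nonneg_pos)
    define b where "b = (\<lambda>n. if n \<in> F then a n / t else 0)"
    have adm: "adm l x b ii"
      unfolding adm_iff
    proof (intro conjI allI)
      fix N v
      have "blinfun_apply ?f (proj {..<N} v) = (\<Sum>n\<in>F \<inter> {..<N}. a n * blinfun_apply (x n (ii n)) v)"
        unfolding blinfun.sum_left using F
        by (intro sum.mono_neutral_cong_right) (auto simp: scaleR_blinfun.rep_eq x_proj[OF sel])
      moreover have "(\<Sum>n<N. b n * blinfun_apply (x n (ii n)) v) = (\<Sum>n\<in>F \<inter> {..<N}. a n * blinfun_apply (x n (ii n)) v) / t"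
        unfolding sum_divide_distrib b_def using F by (intro sum.mono_neutral_cong_right) auto
      moreover have "\<bar>blinfun_apply ?f (proj {..<N} v)\<bar> \<le> t * norm v"
        using norm_blinfun[of ?f "proj {..<N} v"] mult_mono[OF t(2) norm_proj_lessThan_le[of v N]] t(1)
        by simp
      ultimately show "\<bar>\<Sum>n<N. b n * blinfun_apply (x n (ii n)) v\<bar> \<le> norm v"
        using t(1) by (simp add: abs_mult divide_le_eq mult.commute)
    qed (use sel in auto)
    obtain k where k: "(\<lambda>n. (n, ii n)) ` F \<subseteq> init_seg l k"
    proof -
      have "\<forall>\<^sub>F k in sequentially. (\<lambda>n. (n, ii n)) ` F \<subseteq> init_seg l k"
        using F sel_Gam[OF sel] by (intro eventually_init_seg_finite) auto
      then show ?thesis using that eventually_happens[of _ sequentially] by auto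
    qed
    obtain N where N: "\<And>n. (n, ii n) \<in> init_seg l k \<longleftrightarrow> n < N"
      using init_seg_section[of ii l k] sel_Gam[OF sel] by blast
    have "(\<Sum>n\<in>F. a n * c (n, ii n)) / t = (\<Sum>n<N. b n * c (n, ii n))"
      unfolding sum_divide_distrib b_def using k N by (intro sum.mono_neutral_cong_left) auto
    also have "\<dots> \<le> norm (psum (Gam l) c e k)"
      unfolding psum_init_seg sum_init_seg_selcoef[OF N, symmetric]
      by (rule adm_sum_le_norm[OF finite_init_seg init_seg_subset adm])
    also have "\<dots> \<le> M" by (rule bdd)
    finally have "(\<Sum>n\<in>F. a n * c (n, ii n)) \<le> M * t" using t(1) by (simp add: field_simps)
    also have "M * t \<le> M * norm ?f + \<delta>"
    proof -
      have "M * \<delta> \<le> (M + 1) * \<delta>" using \<open>\<delta> > 0\<close> by (simp add: algebra_simps)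
      then have "M * (\<delta> / (M + 1)) \<le> \<delta>" using M by (simp add: field_simps)
      then show ?thesis by (simp add: t_def distrib_left)
    qed
    finally show "(\<Sum>n\<in>F. a n * c (n, ii n)) \<le> M * norm ?f + \<delta>" .
  qed
  obtain \<phi> :: "('v \<Rightarrow>\<^sub>L real) \<Rightarrow>\<^sub>L real" where \<phi>: "\<And>n. blinfun_apply \<phi> (x n (ii n)) = c (n, ii n)"
  proof (rule hahn_banach_helly[where I = UNIV and y = "\<lambda>n. x n (ii n)" and c = "\<lambda>n. c (n, ii n)" and M = M])
    fix \<phi> :: "('v \<Rightarrow>\<^sub>L real) \<Rightarrow>\<^sub>L real"
    assume "\<And>n. n \<in> UNIV \<Longrightarrow> blinfun_apply \<phi> (x n (ii n)) = c (n, ii n)"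
    then show thesis by (intro that) simp
  qed (rule bound, assumption, rule M)
  obtain v where "\<And>f. blinfun_apply \<phi> f = blinfun_apply f v"
    using refl unfolding reflexive_def by blast
  then show ?thesis using that \<phi> by metis
qed

lemma bcomplete_basis_e:
  assumes refl: "reflexive TYPE('v)"
  shows "bcomplete_basis (Gam l) e"
  unfolding bcomplete_basis_def
proof (intro allI impI)
  fix c assume "bounded (range (psum (Gam l) c e))"
  then obtain M where M: "\<And>k. norm (psum (Gam l) c e k) \<le> M"
    by (auto simp: bounded_iff)
  show "convergent (psum (Gam l) c e)"
  proof (rule ccontr)
    assume "\<not> ?thesis"
    then obtain \<eta> where "\<eta> > 0" and
      ex: "\<And>M. \<exists>p q a ii. M \<le> p \<and> p \<le> q \<and> adm l x a ii \<and> \<eta> < (\<Sum>n\<in>{p..<q}. a n * c (n, ii n))"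
      using psum_not_Cauchy_blocks by blast
    define R where "R = (\<lambda>M p q a ii. M \<le> p \<and> p \<le> q \<and> adm l x a ii \<and> \<eta> < (\<Sum>n\<in>{p..<q}. a n * c (n, ii n)))"
    have "\<exists>p q a ii. R M p q a ii" for M unfolding R_def by (rule ex)
    then obtain p q a ii where "\<And>M. R M (p M) (q M) (a M) (ii M)"
      by metis
    then have blk: "M \<le> p M" "p M \<le> q M" "adm l x (a M) (ii M)"
      "\<eta> < (\<Sum>n\<in>{p M..<q M}. a M n * c (n, ii M n))" for M
      by (simp_all add: R_def)
    \<comment> \<open>Each block search starts where the previous block ended, so the block found
      from \<open>s j\<close> lies in the levels from \<open>s j\<close> up to
      \<open>s (Suc j)\<close>, the latter excluded.\<close>
    define s where "s = rec_nat 0 (\<lambda>_. q)"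
    have s_Suc: "s (Suc j) = q (s j)" for j by (simp add: s_def)
    have "p K < q K" for K
      using blk(2)[of K] blk(4)[of K] \<open>\<eta> > 0\<close> by (cases "p K = q K") auto
    then have "s j < s (Suc j)" for j using blk(1)[of "s j"] by (simp add: s_Suc order_le_less_trans)
    then have s: "strict_mono s" by (rule strict_monoI_Suc)
    \<comment> \<open>The glued selection: the \<open>LEAST\<close> term finds the interval that
      contains \<open>n\<close>, and \<open>i\<close> follows there the selection which detects its
      block.\<close>
    define i where "i = (\<lambda>n. ii (s (LEAST j. n < s (Suc j))) n)"
    have i_block: "i n = ii (s j) n" if "s j \<le> n" "n < s (Suc j)" for j n
    proof -
      have "(LEAST j. n < s (Suc j)) = j"
      proof (rule Least_equality)
        fix k assume "n < s (Suc k)"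
        then have "s j < s (Suc k)" using that(1) by simp
        then show "j \<le> k" using s by (simp add: strict_mono_less)
      qed (use that in auto)
      then show ?thesis by (simp add: i_def)
    qed
    have "sel i" using adm_sel[OF blk(3)] by (simp add: i_def)
    then obtain v where v: "\<And>n. blinfun_apply (x n (i n)) v = c (n, i n)"
      using reflexive_represents_selection[OF refl _ M] by blast
    obtain N where N: "\<And>p q. N \<le> p \<Longrightarrow> p \<le> q \<Longrightarrow> norm (proj {p..<q} v) < \<eta>"
      using proj_block_small[OF \<open>\<eta> > 0\<close>] by blast
    \<comment> \<open>Since \<open>s\<close> is strictly increasing,
      \<open>N \<le> s N \<le> p (s N)\<close>; the block found from \<open>s N\<close> lies where
      the blocks of \<open>v\<close> are small.\<close>
    define K where "K = s N"
    have "N \<le> p K" using strict_mono_imp_increasing[OF s, of N] blk(1)[of K] by (simp add: K_def)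
    have "(\<Sum>n\<in>{p K..<q K}. a K n * c (n, ii K n)) = (\<Sum>n\<in>{p K..<q K}. a K n * blinfun_apply (x n (ii K n)) v)"
    proof (rule sum.cong)
      fix n assume "n \<in> {p K..<q K}"
      then have "i n = ii K n" using blk(1)[of K] i_block[of N n] by (simp add: K_def s_Suc)
      then show "a K n * c (n, ii K n) = a K n * blinfun_apply (x n (ii K n)) v" using v[of n] by simp
    qed simp
    also have "\<dots> \<le> norm (proj {p K..<q K} v)"
      by (rule order_trans[OF abs_ge_self adm_block[OF blk(3)]])
    also have "\<dots> < \<eta>" by (rule N[OF \<open>N \<le> p K\<close> blk(2)])
    finally show False using blk(4)[of K] by simp
  qed
qed

end

theorem theorem3p9:
  fixes V :: "nat \<Rightarrow> 'v::banach set"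
    and \<epsilon> :: "nat \<Rightarrow> real"
    and l :: "nat \<Rightarrow> nat"
    and x :: "nat \<Rightarrow> nat \<Rightarrow> ('v \<Rightarrow>\<^sub>L real)"
    and e :: "nat \<times> nat \<Rightarrow> 'w::banach"
  assumes FDD: "is_FDD V"
    and bimon: "bimonotone_FDD V"
    and eps_range: "\<forall>n. 0 < \<epsilon> n \<and> \<epsilon> n < 1"
    and eps_null: "\<epsilon> \<longlonglongrightarrow> 0"
    and eps_sum: "summable \<epsilon>" "(\<Sum>n. \<epsilon> n) < 1/3"
    and net_in_ball: "\<forall>n i. 1 \<le> i \<and> i \<le> l n \<longrightarrow> x n i \<in> dual_comp V n \<and> norm (x n i) \<le> 1"
    and net_nonzero: "\<forall>n i. 1 \<le> i \<and> i \<le> l n \<longrightarrow> x n i \<noteq> 0"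
    and net: "\<forall>n f. f \<in> dual_comp V n \<and> norm f \<le> 1 \<longrightarrow>
                 (\<exists>i. 1 \<le> i \<and> i \<le> l n \<and> norm (f - x n i) \<le> \<epsilon> n)"
    and W_norm: "\<forall>F c. finite F \<and> F \<subseteq> Gam l \<longrightarrow>
                 norm (\<Sum>g\<in>F. c g *\<^sub>R e g) = wnorm l x (\<lambda>g. if g \<in> F then c g else 0)"
    and W_dense: "closure (span (e ` Gam l)) = UNIV"
  shows "(\<exists>c C. 0 < c \<and> (\<forall>v. c * norm v \<le> tnorm l x v \<and> tnorm l x v \<le> C * norm v))
    \<and> lex_basis (Gam l) e
    \<and> (\<exists>J :: 'v \<Rightarrow> 'w. linear J \<and> (\<forall>v. norm (J v) = tnorm l x v) \<and>
         (\<forall>v. (\<lambda>N. \<Sum>n<N. \<Sum>i=1..l n. blinfun_apply (x n i) (coord V n v) *\<^sub>R e (n, i))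
                \<longlonglongrightarrow> J v))
    \<and> (unconditional_FDD V \<longrightarrow> uncond_basis (Gam l) e)
    \<and> (shrinking_FDD V \<longrightarrow> shrinking_basis (Gam l) e)
    \<and> (reflexive TYPE('v) \<longrightarrow> shrinking_basis (Gam l) e \<and> bcomplete_basis (Gam l) e)"
proof -
  \<comment> \<open>The zero functional has to be approximated on each level, so every net is
    nonempty.\<close>
  have "0 \<in> dual_comp V n" for n by (simp add: dual_comp_def)
  then have l_pos: "1 \<le> l n" for n using net by (metis norm_zero order_trans zero_le_one)
  interpret fdd_net_space V l x e
    using FDD bimon l_pos net_in_ball net_nonzero W_norm W_dense
    by unfold_locales auto
  have "norm v / 2 \<le> tnorm l x v" for v
    using tnorm_lower[of \<epsilon> v] eps_range eps_sum net by (simp add: less_imp_le)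
  then have "\<forall>v. 1/2 * norm v \<le> tnorm l x v \<and> tnorm l x v \<le> 1 * norm v"
    using tnorm_le_norm by simp
  then have "\<exists>c C. 0 < c \<and> (\<forall>v. c * norm v \<le> tnorm l x v \<and> tnorm l x v \<le> C * norm v)"
    by (intro exI[of _ "1/2"] exI[of _ 1]) simp
  then show ?thesis
    using lex_basis_e embedding uncond_basis_e shrinking_basis_e bcomplete_basis_e reflexive_imp_shrinking
    by blast
qed

end
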